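(* Suppose $G_0(0)=H_0(0)=0$ and that (NP) $\mathfrak S(\mathcal G)\cap\mathfrak S(\mathcal H)=\emptyset$, i.e. no edge of $\mathcal N_{\mathcal G}$ is parallel to an edge of $\mathcal N_{\mathcal H}$, and (T) the only valid indices on the Newton polygons are vertices: $\mathcal N_{\mathcal G}\cap\Delta(\mathcal G)=\{V_0(\mathcal G),\dots,V_{s(\mathcal G)}(\mathcal G)\}$ and $\mathcal N_{\mathcal H}\cap\Delta(\mathcal H)=\{V_0(\mathcal H),\dots,V_{s(\mathcal H)}(\mathcal H)\}$. Then $$N(\mathcal G)=\Xi(\mathcal A(\mathcal G),\mathcal A_j(\mathcal G))\quad\text{and}\quad N(\mathcal H)=\Xi(\mathcal A(\mathcal H),\mathcal A_j(\mathcal H))$$ if either (i) $j_{s(\mathcal G)}+\tilde j_{s(\mathcal H)}>0$; for each $\varrho=0,\dots,r$, the ordinates of the points in $\Lambda_\varrho(\mathcal G)$ all have the same parity, those in $\Lambda_\varrho(\mathcal H)$ all have the same parity, and these two parities are different; and $C_0,\dots,C_{s(\mathcal G,\mathcal H)}$ have the same sign; or (ii) $j_{s(\mathcal G)}=\tilde j_{s(\mathcal H)}=0$ and all of the following hold: - for each $\varrho=0,\dots,r-1$, the ordinates of the points in $\Lambda_\varrho(\mathcal G)$ all have the same parity, those in $\Lambda_\varrho(\mathcal H)$ all have the same parity, and these two parities are different; moreover the ordinates of the points of $\Lambda_r(\mathcal G)$ with its last element $V_{s(\mathcal G)}(\mathcal G)$ removed are all odd, and those of $\Lambda_r(\mathcal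 H)$ are all even; - $\mathcal N_{\mathcal G}$ (and $\mathcal N_{\mathcal H}$) contains at least two valid indices of $\mathcal G$ (of $\mathcal H$), the last two of which, in order of increasing abscissa along the polygon, are $V_*(\mathcal G)=(i_*,j_* )$ and $V_{s(\mathcal G)}(\mathcal G)=(i_{s(\mathcal G)},0)$ (respectively $V_*(\mathcal H)=(\tilde i_*,\tilde j_* )$ and $V_{s(\mathcal H)}(\mathcal H)=(\tilde i_{s(\mathcal H)},0)$), and $\{(i,j)\in\Delta(\mathcal G):0<j<j_*\}=\emptyset$ and $\{(i,j)\in\Delta(\mathcal H):0<j<\tilde j_*\}=\emptyset$; - $\zeta(E_{s(\mathcal G)}(\mathcal G))>\zeta(E_{s(\mathcal H)}(\mathcal H))$ and $j_*\le\tilde j_*$; - $C_0,\dots,C_{s(\mathcal G,\mathcal H)-1}$ have the same sign.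
   Context: **Vector field.** Let $\mathcal X=\sum_{k\ge m}X_k$ and $\mathcal Y=\sum_{k\ge m}Y_k$ be real analytic near $(0,0)\in\mathbb R^2$, where $X_k,Y_k$ are homogeneous polynomials of degree $k$, $m\ge 2$, $X_m^2+Y_m^2\not\equiv 0$, and the origin $O$ is an isolated singular point of the system $\dot x=\mathcal X(x,y),\ \dot y=\mathcal Y(x,y)$. In polar coordinates, after dividing by $\rho^{m-1}$, the system becomes $\dot\rho=\rho\mathcal H(\rho,\theta),\ \dot\theta=\mathcal G(\rho,\theta)$ with $\mathcal H=\sum_{k\ge0}H_k(\theta)\rho^k$, $\mathcal G=\sum_{k\ge0}G_k(\theta)\rho^k$, $G_k(\theta)=Y_{k+m}(\cos\theta,\sin\theta)\cos\theta-X_{k+m}(\cos\theta,\sin\theta)\sin\theta$, $H_k(\theta)=X_{k+m}(\cos\theta,\sin\theta)\cos\theta+Y_{k+m}(\cos\theta,\sin\theta)\sin\theta$. It is assumed throughout that neither $\mathcal G$ nor $\mathcal H$ is identically $0$. **Newton polygons.** For a nonzero real analytic $F(\rho,\theta)=\sum a_{i,j}(F)\rho^i\theta^j$ near $(0,0)$, let $\Delta(F)=\{(i,j)\in\mathbb Z_{\ge0}^2:a_{i,j}(F)\ne0\}$ (valid indices) and let the Newton polygon $\mathcal N_F$ be the compact polygon in the boundary of $\mathrm{conv}(\Delta(F)+\mathbb R_{\ge0}^2)$ in the $(u,v)$-plane (the boundary minus its vertical and horizontal rays; possibly a single point). Its vertices, ordered by increasing abscissa, are $V_0(F),\dots,V_{s(F)}(F)$;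 write $V_k(\mathcal G)=(i_k,j_k)$ and $V_k(\mathcal H)=(\tilde i_k,\tilde j_k)$. $E_k(F)$ is the edge (closed segment) from $V_{k-1}(F)$ to $V_k(F)$, with slope $\zeta(E_k(F))<0$; put $\zeta(E_0(F))=-\infty$, $\zeta(E_{s(F)+1}(F))=0$, $\zeta^-(V_k(F))=\zeta(E_k(F))$, $\zeta^+(V_k(F))=\zeta(E_{k+1}(F))$. $\mathfrak S(F)$ is the set of slopes of edges of $\mathcal N_F$. For $\xi<0$ the $\xi$-component $\sigma(F,\xi)$ is $E_k(F)$ if $\xi=\zeta(E_k(F))$, and $V_k(F)$ if $\zeta^-(V_k(F))<\xi<\zeta^+(V_k(F))$. The $\xi$-componential polynomial is $\mathcal K_\xi(F)(\theta)=\sum_{(i,j)\in\sigma(F,\xi)\cap\Delta(F)}a_{i,j}(F)\theta^j$. **Slope sequences.** Let $\xi_1<\dots<\xi_{s(\mathcal G,\mathcal H)}$ be the elements of $\mathfrak S(\mathcal G)\cup\mathfrak S(\mathcal H)$ and $\xi_{s_1}<\dots<\xi_{s_r}$ ($r=r(\mathcal G,\mathcal H)\ge0$) those of $\mathfrak S(\mathcal G)\cap\mathfrak S(\mathcal H)$. The vertex sequence $(V_0(\mathcal G),\dots,V_{s(\mathcal G)}(\mathcal G))$ is divided into $r+1$ consecutive subsequences $\Lambda_\varrho(\mathcal G)=(V_{k_{\varrho-1}+1}(\mathcal G),\dots,V_{k_\varrho}(\mathcal G))$, $\varrho=0,\dots,r$, where $-1=k_{-1}<k_0<\dots<k_r=s(\mathcal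 G)$ and $\zeta^+(V_{k_\varrho}(\mathcal G))=\xi_{s_{\varrho+1}}$ for $\varrho=0,\dots,r-1$ (so $\Lambda_0(\mathcal G)$ is the whole vertex sequence if $r=0$). $\Lambda_\varrho(\mathcal H)$ is defined similarly. **The constants $C_k$.** Put $D_0(\mathcal G)=V_0(\mathcal G)$ and, for $k=1,\dots,s(\mathcal G,\mathcal H)$, $D_k(\mathcal G)=V_{n}(\mathcal G)$ where $n\in\{0,\dots,s(\mathcal G)\}$ is the index with $\xi_k\in[\zeta^-(V_n(\mathcal G)),\zeta^+(V_n(\mathcal G)))$; define $D_k(\mathcal H)$ similarly. With $j(D)$ the ordinate of a point $D$ and $a_{D_k(\mathcal G)}$ (resp. $a_{D_k(\mathcal H)}$) the coefficient of $\mathcal G$ (resp. $\mathcal H$) at that vertex, $C_k=(j(D_k(\mathcal G))-j(D_k(\mathcal H)))\,a_{D_k(\mathcal G)}\,a_{D_k(\mathcal H)}$, $k=0,\dots,s(\mathcal G,\mathcal H)$. **Numbers.** $\chi(\mathcal G)=\sum_{\xi\in\mathfrak S(\mathcal G)}\#\{\theta\in\mathbb R\setminus\{0\}:\mathcal K_\xi(\mathcal G)(\theta)=0\}$; $N(\mathcal G)=\chi(\mathcal G)$ if $j_{s(\mathcal G)}=0$ and $\chi(\mathcal G)+1$ if $j_{s(\mathcal G)}>0$; $N(\mathcal H)$ is defined in the same way. $\mathcal A(\mathcal G)=(a_{i_0,j_0}(\mathcal G),\dots,a_{i_{s(\mathcal G)},j_{s(\mathcal G)}}(\mathcal G))$ and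 $\mathcal A_j(\mathcal G)=((-1)^{j_{s(\mathcal G)}}a_{i_{s(\mathcal G)},j_{s(\mathcal G)}}(\mathcal G),\dots,(-1)^{j_0}a_{i_0,j_0}(\mathcal G))$; similarly for $\mathcal H$. $(A,B)$ denotes concatenation of finite sequences, and $\Xi(A)$ the number of sign changes in a sequence $A$ of nonzero reals. *)

theory Defs
  imports "HOL-Analysis.Analysis"
begin

subsection \<open>Functions of two real variables that are analytic near the origin\<close>

definition has_expansion :: "(real \<Rightarrow> real \<Rightarrow> real) \<Rightarrow> (nat \<Rightarrow> nat \<Rightarrow> real) \<Rightarrow> bool" where
  "has_expansion F a \<longleftrightarrow>
     (\<exists>r>0. \<forall>x y. \<bar>x\<bar> < r \<and> \<bar>y\<bar> < r \<longrightarrow> ((\<lambda>(i, j). a i j * x ^ i * y ^ j) has_sum F x y) UNIV)"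

definition analytic_at_origin :: "(real \<Rightarrow> real \<Rightarrow> real) \<Rightarrow> bool" where
  "analytic_at_origin F \<longleftrightarrow> (\<exists>a. has_expansion F a)"

text \<open>\<open>coef F i j\<close> is the coefficient of the monomial of degree \<open>i\<close> in the first and \<open>j\<close>
  in the second variable. It is meaningful for \<open>analytic_at_origin F\<close>; see \<open>coef_eqI\<close>.\<close>

definition coef :: "(real \<Rightarrow> real \<Rightarrow> real) \<Rightarrow> nat \<Rightarrow> nat \<Rightarrow> real" where
  "coef F = (THE a. has_expansion F a)"

lemma powser_zero_coeffs:
  fixes c :: "nat \<Rightarrow> real"
  assumes "r > 0" and "\<And>x. \<bar>x\<bar> < r \<Longrightarrow> (\<lambda>n. c n * x ^ n) sums 0"
  shows "c n = 0"
proof (induction n rule: less_induct)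
  case (less n)
  have "((\<lambda>_. 0) \<longlongrightarrow> c (0 + n)) (at (0::real))"
  proof (rule powser_limit_0_strong[OF assms(1)])
    fix x :: real assume x: "x \<noteq> 0" "norm x < r"
    have "(\<lambda>k. c (k + n) * x ^ (k + n)) sums 0"
      using sums_split_initial_segment[OF assms(2)[of x], of n] x less by simp
    then have "(\<lambda>k. inverse (x ^ n) * (c (k + n) * x ^ (k + n))) sums 0"
      using sums_mult[of "\<lambda>k. c (k + n) * x ^ (k + n)" 0] by simp
    then show "(\<lambda>k. c (k + n) * x ^ k) sums 0"
      using x by (simp add: power_add field_simps)
  qed
  then show ?case by (simp add: tendsto_const_iff)
qed

lemma has_expansion_unique:
  assumes "has_expansion F a" and "has_expansion F b"
  shows "a = b"
proof -
  obtain r1 r2 where r: "r1 > 0" "r2 > 0"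
    and 1: "\<And>x y. \<bar>x\<bar> < r1 \<and> \<bar>y\<bar> < r1 \<Longrightarrow> ((\<lambda>(i, j). a i j * x ^ i * y ^ j) has_sum F x y) UNIV"
    and 2: "\<And>x y. \<bar>x\<bar> < r2 \<and> \<bar>y\<bar> < r2 \<Longrightarrow> ((\<lambda>(i, j). b i j * x ^ i * y ^ j) has_sum F x y) UNIV"
    using assms unfolding has_expansion_def by blast
  define r where "r = min r1 r2"
  define d where "d i j = a i j - b i j" for i j
  have r0: "r > 0" using r by (simp add: r_def)
  have d: "((\<lambda>(i, j). d i j * x ^ i * y ^ j) has_sum 0) UNIV" if "\<bar>x\<bar> < r" "\<bar>y\<bar> < r" for x y
    using has_sum_add[OF 1[of x y] has_sum_cmult_right[OF 2[of x y], of "-1"]] that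
    by (simp add: r_def d_def case_prod_unfold algebra_simps)
  have sec: "(\<lambda>j. d i j * y ^ j) summable_on UNIV" if y: "\<bar>y\<bar> < r" for i y
  proof -
    have "(\<lambda>(i, j). d i j * (r/2) ^ i * y ^ j) summable_on Sigma UNIV (\<lambda>_. UNIV)"
      using d[of "r/2" y] r0 y by (auto simp: summable_on_def)
    then have "(\<lambda>j. d i j * (r/2) ^ i * y ^ j) summable_on UNIV"
      by (rule summable_on_SigmaD1) auto
    then have "(\<lambda>j. (2/r) ^ i * (d i j * (r/2) ^ i * y ^ j)) summable_on UNIV"
      by (rule summable_on_cmult_right)
    then show ?thesis using r0 by (simp add: power_divide field_simps)
  qed
  have row: "infsum (\<lambda>j. d i j * y ^ j) UNIV = 0" if y: "\<bar>y\<bar> < r" for i y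
  proof (rule powser_zero_coeffs[OF r0, where c = "\<lambda>i. infsum (\<lambda>j. d i j * y ^ j) UNIV"])
    fix x :: real assume x: "\<bar>x\<bar> < r"
    have "((\<lambda>i. infsum (\<lambda>j. d i j * y ^ j) UNIV * x ^ i) has_sum 0) UNIV"
    proof (rule has_sum_SigmaD[where B = "\<lambda>_. UNIV"])
      show "((\<lambda>(i, j). d i j * x ^ i * y ^ j) has_sum 0) (Sigma UNIV (\<lambda>_. UNIV))"
        using d[OF x y] by simp
    next
      fix i :: nat
      show "((\<lambda>j. case (i, j) of (i, j) \<Rightarrow> d i j * x ^ i * y ^ j) has_sum
              infsum (\<lambda>j. d i j * y ^ j) UNIV * x ^ i) UNIV"
        using has_sum_cmult_left[OF has_sum_infsum[OF sec[OF y]], of i "x ^ i"]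
        by (simp add: mult_ac)
    qed
    then show "(\<lambda>i. infsum (\<lambda>j. d i j * y ^ j) UNIV * x ^ i) sums 0"
      by (rule has_sum_imp_sums)
  qed
  have "d i j = 0" for i j
  proof (rule powser_zero_coeffs[OF r0])
    fix y :: real assume y: "\<bar>y\<bar> < r"
    show "(\<lambda>j. d i j * y ^ j) sums 0"
      using has_sum_imp_sums[OF has_sum_infsum[OF sec[OF y]]] row[OF y] by metis
  qed
  then show ?thesis by (auto simp: d_def fun_eq_iff)
qed

lemma coef_eqI: "has_expansion F a \<Longrightarrow> coef F = a"
  unfolding coef_def by (blast intro: the_equality has_expansion_unique)


subsection \<open>The vector field in polar coordinates\<close>

definition hom_part :: "(real \<Rightarrow> real \<Rightarrow> real) \<Rightarrow> nat \<Rightarrow> real \<Rightarrow> real \<Rightarrow> real" where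
  "hom_part F k x y = (\<Sum>i\<le>k. coef F i (k - i) * x ^ i * y ^ (k - i))"

definition ang_coeff :: "nat \<Rightarrow> (real \<Rightarrow> real \<Rightarrow> real) \<Rightarrow> (real \<Rightarrow> real \<Rightarrow> real) \<Rightarrow> nat \<Rightarrow> real \<Rightarrow> real" where
  "ang_coeff m X Y k \<theta> =
     hom_part Y (k + m) (cos \<theta>) (sin \<theta>) * cos \<theta> - hom_part X (k + m) (cos \<theta>) (sin \<theta>) * sin \<theta>"

definition rad_coeff :: "nat \<Rightarrow> (real \<Rightarrow> real \<Rightarrow> real) \<Rightarrow> (real \<Rightarrow> real \<Rightarrow> real) \<Rightarrow> nat \<Rightarrow> real \<Rightarrow> real" where
  "rad_coeff m X Y k \<theta> =
     hom_part X (k + m) (cos \<theta>) (sin \<theta>) * cos \<theta> + hom_part Y (k + m) (cos \<theta>) (sin \<theta>) * sin \<theta>"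

text \<open>The polar system is \<open>\<rho>' = \<rho> * radial \<rho> \<theta>\<close>, \<open>\<theta>' = angular \<rho> \<theta>\<close>, after division by
  \<open>\<rho> ^ (m - 1)\<close>; both series converge for small \<open>\<bar>\<rho>\<bar>\<close>, uniformly in \<open>\<theta>\<close>.\<close>

definition angular :: "nat \<Rightarrow> (real \<Rightarrow> real \<Rightarrow> real) \<Rightarrow> (real \<Rightarrow> real \<Rightarrow> real) \<Rightarrow> real \<Rightarrow> real \<Rightarrow> real" where
  "angular m X Y \<rho> \<theta> = (\<Sum>k. ang_coeff m X Y k \<theta> * \<rho> ^ k)"

definition radial :: "nat \<Rightarrow> (real \<Rightarrow> real \<Rightarrow> real) \<Rightarrow> (real \<Rightarrow> real \<Rightarrow> real) \<Rightarrow> real \<Rightarrow> real \<Rightarrow> real" where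
  "radial m X Y \<rho> \<theta> = (\<Sum>k. rad_coeff m X Y k \<theta> * \<rho> ^ k)"


subsection \<open>Newton polygons\<close>

definition valid_indices :: "(real \<Rightarrow> real \<Rightarrow> real) \<Rightarrow> (nat \<times> nat) set" where
  "valid_indices F = {(i, j). coef F i j \<noteq> 0}"

definition pt :: "nat \<times> nat \<Rightarrow> real \<times> real" where
  "pt z = (real (fst z), real (snd z))"

definition newton_region :: "(real \<Rightarrow> real \<Rightarrow> real) \<Rightarrow> (real \<times> real) set" where
  "newton_region F = convex hull {pt z + (u, v) | z u v. z \<in> valid_indices F \<and> u \<ge> 0 \<and> v \<ge> 0}"

text \<open>A boundary point lies on the vertical (horizontal) ray of the boundary, and is not the
  endpoint of that ray, iff some point of the region lies strictly below it (to the left of it).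
  The endpoints of the two rays belong to the polygon.\<close>

definition newton_polygon :: "(real \<Rightarrow> real \<Rightarrow> real) \<Rightarrow> (real \<times> real) set" where
  "newton_polygon F = frontier (newton_region F)
     - {(u, v). \<exists>v'<v. (u, v') \<in> newton_region F}
     - {(u, v). \<exists>u'<u. (u', v) \<in> newton_region F}"

text \<open>The vertices, which are all valid indices, ordered by increasing abscissa; no two of them
  have the same abscissa.\<close>

definition vertices :: "(real \<Rightarrow> real \<Rightarrow> real) \<Rightarrow> (nat \<times> nat) list" where
  "vertices F = sorted_key_list_of_set fst {z. pt z extreme_point_of newton_region F}"

abbreviation vertex :: "(real \<Rightarrow> real \<Rightarrow> real) \<Rightarrow> nat \<Rightarrow> nat \<times> nat" where
  "vertex F k \<equiv> vertices F ! k"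

definition num_edges :: "(real \<Rightarrow> real \<Rightarrow> real) \<Rightarrow> nat" where
  "num_edges F = length (vertices F) - 1"

text \<open>\<open>edge F k\<close> and \<open>edge_slope F k\<close> are meant for \<open>1 \<le> k \<le> num_edges F\<close>.\<close>

definition edge :: "(real \<Rightarrow> real \<Rightarrow> real) \<Rightarrow> nat \<Rightarrow> (real \<times> real) set" where
  "edge F k = closed_segment (pt (vertex F (k - 1))) (pt (vertex F k))"

definition edge_slope :: "(real \<Rightarrow> real \<Rightarrow> real) \<Rightarrow> nat \<Rightarrow> real" where
  "edge_slope F k =
     (real (snd (vertex F k)) - real (snd (vertex F (k - 1))))
     / (real (fst (vertex F k)) - real (fst (vertex F (k - 1))))"

definition slopes :: "(real \<Rightarrow> real \<Rightarrow> real) \<Rightarrow> real set" where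
  "slopes F = edge_slope F ` {1..num_edges F}"

text \<open>\<open>\<zeta>(E\<^sub>k)\<close> with the conventions for \<open>k = 0\<close> and \<open>k = num_edges F + 1\<close>.\<close>

definition zeta :: "(real \<Rightarrow> real \<Rightarrow> real) \<Rightarrow> nat \<Rightarrow> ereal" where
  "zeta F k = (if k = 0 then - \<infinity> else if k \<le> num_edges F then ereal (edge_slope F k) else 0)"

definition zeta_minus :: "(real \<Rightarrow> real \<Rightarrow> real) \<Rightarrow> nat \<Rightarrow> ereal" where
  "zeta_minus F k = zeta F k"

definition zeta_plus :: "(real \<Rightarrow> real \<Rightarrow> real) \<Rightarrow> nat \<Rightarrow> ereal" where
  "zeta_plus F k = zeta F (k + 1)"

text \<open>The slopes \<open>\<zeta>(E\<^sub>k)\<close> strictly increase with \<open>k\<close>, so for \<open>\<xi> < 0\<close> the union below has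
  exactly one nonempty member: the edge of slope \<open>\<xi>\<close> or the vertex selected by \<open>\<xi>\<close>.\<close>

definition component :: "(real \<Rightarrow> real \<Rightarrow> real) \<Rightarrow> real \<Rightarrow> (real \<times> real) set" where
  "component F \<xi> =
     (\<Union>k\<in>{k \<in> {1..num_edges F}. \<xi> = edge_slope F k}. edge F k) \<union>
     (\<Union>k\<in>{k \<in> {0..num_edges F}. zeta_minus F k < ereal \<xi> \<and> ereal \<xi> < zeta_plus F k}. {pt (vertex F k)})"

definition comp_poly :: "real \<Rightarrow> (real \<Rightarrow> real \<Rightarrow> real) \<Rightarrow> real \<Rightarrow> real" where
  "comp_poly \<xi> F \<theta> =
     (\<Sum>(i, j)\<in>{z \<in> valid_indices F. pt z \<in> component F \<xi>}. coef F i j * \<theta> ^ j)"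


subsection \<open>Slope sequences and the constants \<open>C\<^sub>k\<close>\<close>

definition all_slopes :: "(real \<Rightarrow> real \<Rightarrow> real) \<Rightarrow> (real \<Rightarrow> real \<Rightarrow> real) \<Rightarrow> real list" where
  "all_slopes G H = sorted_list_of_set (slopes G \<union> slopes H)"

definition common_slopes :: "(real \<Rightarrow> real \<Rightarrow> real) \<Rightarrow> (real \<Rightarrow> real \<Rightarrow> real) \<Rightarrow> real list" where
  "common_slopes G H = sorted_list_of_set (slopes G \<inter> slopes H)"

text \<open>\<open>cut_index \<Xi>\<^sub>0 F \<rho>\<close> is \<open>k\<^sub>\<rho>\<close>, and \<open>block \<Xi>\<^sub>0 F \<rho>\<close> is \<open>\<Lambda>\<^sub>\<rho>(F)\<close>, for \<open>\<Xi>\<^sub>0\<close> the list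
  of common slopes. Lists are indexed from 0, so \<open>\<Xi>\<^sub>0 ! \<rho>\<close> is the common slope number \<open>\<rho> + 1\<close>.\<close>

definition cut_index :: "real list \<Rightarrow> (real \<Rightarrow> real \<Rightarrow> real) \<Rightarrow> nat \<Rightarrow> nat" where
  "cut_index cs F \<rho> =
     (if \<rho> < length cs then (THE k. k \<le> num_edges F \<and> zeta_plus F k = ereal (cs ! \<rho>))
      else num_edges F)"

definition block :: "real list \<Rightarrow> (real \<Rightarrow> real \<Rightarrow> real) \<Rightarrow> nat \<Rightarrow> (nat \<times> nat) list" where
  "block cs F \<rho> =
     (let b = (if \<rho> = 0 then 0 else cut_index cs F (\<rho> - 1) + 1)
      in map (vertex F) [b..<cut_index cs F \<rho> + 1])"

text \<open>\<open>D_pt xs F k\<close> is \<open>D\<^sub>k(F)\<close>, for \<open>xs\<close> the increasing list \<open>\<xi>\<^sub>1, \<xi>\<^sub>2, \<dots>\<close> of all slopes.\<close>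

definition D_pt :: "real list \<Rightarrow> (real \<Rightarrow> real \<Rightarrow> real) \<Rightarrow> nat \<Rightarrow> nat \<times> nat" where
  "D_pt xs F k =
     (if k = 0 then vertex F 0
      else vertex F (THE n. n \<le> num_edges F \<and>
             zeta_minus F n \<le> ereal (xs ! (k - 1)) \<and> ereal (xs ! (k - 1)) < zeta_plus F n))"

definition C_const :: "(real \<Rightarrow> real \<Rightarrow> real) \<Rightarrow> (real \<Rightarrow> real \<Rightarrow> real) \<Rightarrow> nat \<Rightarrow> real" where
  "C_const G H k =
     (let (i, j) = D_pt (all_slopes G H) G k; (i', j') = D_pt (all_slopes G H) H k
      in (real j - real j') * coef G i j * coef H i' j')"

definition same_sign :: "real set \<Rightarrow> bool" where
  "same_sign A \<longleftrightarrow> (\<forall>c\<in>A. c > 0) \<or> (\<forall>c\<in>A. c < 0)"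

definition opposite_parities :: "(nat \<times> nat) list \<Rightarrow> (nat \<times> nat) list \<Rightarrow> bool" where
  "opposite_parities A B \<longleftrightarrow>
     (\<forall>z\<in>set A. even (snd z)) \<and> (\<forall>z\<in>set B. odd (snd z)) \<or>
     (\<forall>z\<in>set A. odd (snd z)) \<and> (\<forall>z\<in>set B. even (snd z))"


subsection \<open>Numbers of roots and sign changes\<close>

definition chi :: "(real \<Rightarrow> real \<Rightarrow> real) \<Rightarrow> nat" where
  "chi F = (\<Sum>\<xi>\<in>slopes F. card {\<theta>. \<theta> \<noteq> 0 \<and> comp_poly \<xi> F \<theta> = 0})"

definition last_ordinate :: "(real \<Rightarrow> real \<Rightarrow> real) \<Rightarrow> nat" where
  "last_ordinate F = snd (vertex F (num_edges F))"

definition N_num :: "(real \<Rightarrow> real \<Rightarrow> real) \<Rightarrow> nat" where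
  "N_num F = (if last_ordinate F = 0 then chi F else chi F + 1)"

definition A_seq :: "(real \<Rightarrow> real \<Rightarrow> real) \<Rightarrow> real list" where
  "A_seq F = map (\<lambda>(i, j). coef F i j) (vertices F)"

definition Aj_seq :: "(real \<Rightarrow> real \<Rightarrow> real) \<Rightarrow> real list" where
  "Aj_seq F = rev (map (\<lambda>(i, j). (- 1) ^ j * coef F i j) (vertices F))"

definition sign_changes :: "real list \<Rightarrow> nat" where
  "sign_changes A = card {k. k + 1 < length A \<and> A ! k * A ! (k + 1) < 0}"


subsection \<open>The last two valid indices on the Newton polygon\<close>

definition polygon_indices :: "(real \<Rightarrow> real \<Rightarrow> real) \<Rightarrow> (nat \<times> nat) list" where
  "polygon_indices F = sorted_key_list_of_set fst {z \<in> valid_indices F. pt z \<in> newton_polygon F}"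

text \<open>The last entry of \<open>polygon_indices F\<close> is the last vertex; the one before it is \<open>V\<^sub>*(F)\<close>,
  provided there are at least two entries.\<close>

definition star_ordinate :: "(real \<Rightarrow> real \<Rightarrow> real) \<Rightarrow> nat" where
  "star_ordinate F = snd (polygon_indices F ! (length (polygon_indices F) - 2))"

end

theory Submission
  imports Defs
begin

text \<open>Let \<open>F\<close> be one of \<open>G\<close>, \<open>H\<close>. If the only valid indices on the Newton polygon of \<open>F\<close> are
  its vertices, then the polynomial of an edge from \<open>(i, j)\<close> to \<open>(i', j')\<close> is a binomial
  \<open>a\<theta>\<^sup>j + b\<theta>\<^sup>j\<^sup>'\<close> (\<open>comp_poly_binomial\<close>). For a binomial, Descartes' rule is exact: there
  is one positive root if \<open>ab < 0\<close> and none otherwise, and the same test applied to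
  \<open>(- 1) ^ j * a\<close> and \<open>(- 1) ^ j' * b\<close> counts the negative roots
  (\<open>card_nonzero_roots_binomial\<close>). Summed over the edges, the first test counts the sign changes
  inside \<open>A_seq F\<close>, and the second those inside \<open>Aj_seq F\<close>; hence \<open>chi F\<close> is the number of sign
  changes of the concatenation, except for the one place where the two sequences meet. There the
  neighbours are \<open>a\<close> and \<open>(- 1) ^ j * a\<close>, where \<open>j\<close> is the last ordinate and \<open>a\<close> the
  coefficient at the last vertex, so that place contributes a change if and only if \<open>j\<close> is odd,
  while \<open>N_num F\<close> adds one to \<open>chi F\<close> if and only if \<open>j > 0\<close>. The identity therefore
  follows once the last ordinate is known to be zero or odd (\<open>N_num_eq_sign_changes\<close>).

  In case (ii) both last ordinates are zero. In case (i) there are no common slopes, so the single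
  block of vertices is the whole vertex sequence, and the parity condition makes one of the two last
  ordinates odd. The other one is zero: the last ordinate is the least exponent of \<open>\<theta>\<close>
  (\<open>last_ordinate_le\<close>), so if both were positive, the vector field would vanish along the ray
  \<open>\<theta> = 0\<close>, and the origin would not be an isolated singular point
  (\<open>isolated_imp_some_pure_power\<close>).

  Two facts have to be supplied for this. One is the geometry of the polygon: each vertex
  lies strictly below the chord of its neighbours, each edge spans a supporting line of the region, and
  thus the edges have distinct slopes and lie on the polygon. The other is that \<open>G\<close> and
  \<open>H\<close> are nonzero power series in \<open>(\<rho>, \<theta>)\<close> with the expected coefficients; the substitution
  \<open>x = \<rho> cos \<theta>\<close>, \<open>y = \<rho> sin \<theta>\<close> is controlled by a submultiplicative norm of the Taylor
  series in \<open>\<theta>\<close>.\<close>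

section \<open>Sign changes and the roots of binomials\<close>

lemma sign_changes_Nil [simp]: "sign_changes [] = 0"
  and sign_changes_singleton [simp]: "sign_changes [x] = 0"
  by (simp_all add: sign_changes_def)

lemma sign_changes_conv_sum:
  "sign_changes xs = (\<Sum>k<length xs - 1. of_bool (xs ! k * xs ! (k + 1) < 0))"
proof -
  have "{k. k + 1 < length xs \<and> xs ! k * xs ! (k + 1) < 0} =
      {..<length xs - 1} \<inter> {k. xs ! k * xs ! (k + 1) < 0}"
    by auto
  then show ?thesis by (simp add: sign_changes_def)
qed

lemma sign_changes_Cons [simp]:
  "sign_changes (x # y # zs) = of_bool (x * y < 0) + sign_changes (y # zs)"
  by (simp add: sign_changes_conv_sum sum.lessThan_Suc_shift del: sum.lessThan_Suc)

lemma sign_changes_append: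
  assumes "xs \<noteq> []" "ys \<noteq> []"
  shows "sign_changes (xs @ ys) = sign_changes xs + of_bool (last xs * hd ys < 0) + sign_changes ys"
  using assms(1)
proof (induction xs rule: induct_list012)
  case (2 x)
  then show ?case using assms(2) by (cases ys) simp_all
qed simp_all

lemma sign_changes_rev [simp]: "sign_changes (rev xs) = sign_changes xs"
proof (induction xs rule: induct_list012)
  case (3 x y zs)
  have "sign_changes (rev (x # y # zs)) = sign_changes (rev (y # zs) @ [x])" by simp
  also have "\<dots> = sign_changes (y # zs) + of_bool (y * x < 0)"
    using 3 by (subst sign_changes_append) (simp_all add: last_rev)
  finally show ?case by (simp add: mult.commute)
qed simp_all

text \<open>Dividing by \<open>\<theta>\<^sup>q\<close> turns the equation into \<open>\<theta>\<^sup>n = - b / a\<close> with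
  \<open>n = p - q > 0\<close>. So for binomials Descartes' rule of signs counts the positive roots exactly.\<close>

lemma pos_roots_binomial:
  fixes a b :: real
  assumes "a \<noteq> 0" "b \<noteq> 0" "q < p"
  shows "finite {\<theta>. \<theta> > 0 \<and> a * \<theta> ^ p + b * \<theta> ^ q = 0}"
    and "card {\<theta>. \<theta> > 0 \<and> a * \<theta> ^ p + b * \<theta> ^ q = 0} = of_bool (a * b < 0)"
proof -
  define n where "n = p - q"
  have n: "n > 0" "p = n + q" using assms by (auto simp: n_def)
  have eq: "a * \<theta> ^ p + b * \<theta> ^ q = 0 \<longleftrightarrow> \<theta> ^ n = - b / a" if "\<theta> > 0" for \<theta>
  proof -
    have "a * \<theta> ^ p + b * \<theta> ^ q = (a * \<theta> ^ n + b) * \<theta> ^ q"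
      unfolding n(2) by (simp add: power_add algebra_simps)
    also have "\<dots> = 0 \<longleftrightarrow> a * \<theta> ^ n + b = 0" using that by simp
    also have "\<dots> \<longleftrightarrow> \<theta> ^ n = - b / a" 
      unfolding nonzero_eq_divide_eq[OF assms(1)] by (simp add: eq_neg_iff_add_eq_0 mult.commute)
    finally show ?thesis .
  qed
  have set: "{\<theta>. \<theta> > 0 \<and> a * \<theta> ^ p + b * \<theta> ^ q = 0} = (if a * b < 0 then {root n (- b / a)} else {})"
  proof (cases "a * b < 0")
    case True
    then have "- b / a > 0" by (auto simp: mult_less_0_iff zero_less_divide_iff divide_less_0_iff)
    then have "root n (- b / a) > 0" "root n (- b / a) ^ n = - b / a"
      using n(1) by (simp_all only: real_root_gt_zero real_root_pow_pos)
    moreover have "\<theta> = root n (- b / a)" if "\<theta> > 0" "\<theta> ^ n = - b / a" for \<theta>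
      using real_root_pos_unique[of n \<theta> "- b / a"] that n(1) by simp
    ultimately have "{\<theta>. \<theta> > 0 \<and> a * \<theta> ^ p + b * \<theta> ^ q = 0} = {root n (- b / a)}"
      using eq by blast
    then show ?thesis unfolding if_P[OF True] .
  next
    case False
    then have "- b / a \<le> 0"
      using assms by (auto simp: mult_less_0_iff zero_le_divide_iff)
    then have "\<theta> ^ n \<noteq> - b / a" if "\<theta> > 0" for \<theta> using that zero_less_power[of \<theta> n] by linarith
    then have "{\<theta>. \<theta> > 0 \<and> a * \<theta> ^ p + b * \<theta> ^ q = 0} = {}"
      using eq by blast
    then show ?thesis unfolding if_not_P[OF False] .
  qed
  show "finite {\<theta>. \<theta> > 0 \<and> a * \<theta> ^ p + b * \<theta> ^ q = 0}"
    and "card {\<theta>. \<theta> > 0 \<and> a * \<theta> ^ p + b * \<theta> ^ q = 0} = of_bool (a * b < 0)"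
    unfolding set by simp_all
qed

text \<open>The negative roots are the reflected positive roots of the polynomial with \<open>\<theta>\<close> replaced by
  \<open>- \<theta>\<close>, whose coefficients are \<open>(- 1) ^ p * a\<close> and \<open>(- 1) ^ q * b\<close>.\<close>

lemma card_nonzero_roots_binomial:
  fixes a b :: real
  assumes "a \<noteq> 0" "b \<noteq> 0" "q < p"
  shows "card {\<theta>. \<theta> \<noteq> 0 \<and> a * \<theta> ^ p + b * \<theta> ^ q = 0} =
    of_bool (a * b < 0) + of_bool (((- 1) ^ p * a) * ((- 1) ^ q * b) < 0)"
proof -
  let ?a = "(- 1) ^ p * a" and ?b = "(- 1) ^ q * b"
  let ?P = "{\<theta>. \<theta> > 0 \<and> a * \<theta> ^ p + b * \<theta> ^ q = 0}"
  let ?N = "{\<theta>. \<theta> > 0 \<and> ?a * \<theta> ^ p + ?b * \<theta> ^ q = 0}"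
  have "?a \<noteq> 0" "?b \<noteq> 0" using assms by simp_all
  note N = pos_roots_binomial[OF this assms(3)]
  have reflect: "?a * \<theta> ^ p + ?b * \<theta> ^ q = a * (- \<theta>) ^ p + b * (- \<theta>) ^ q" for \<theta>
    by (simp add: power_minus[of \<theta>])
  have "{\<theta>. \<theta> \<noteq> 0 \<and> a * \<theta> ^ p + b * \<theta> ^ q = 0} = ?P \<union> uminus ` ?N"
  proof (intro equalityI subsetI)
    fix \<theta> assume \<theta>: "\<theta> \<in> {\<theta>. \<theta> \<noteq> 0 \<and> a * \<theta> ^ p + b * \<theta> ^ q = 0}"
    show "\<theta> \<in> ?P \<union> uminus ` ?N"
    proof (cases "\<theta> > 0")
      case False
      then have "- \<theta> \<in> ?N" unfolding reflect using \<theta> by simp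
      then have "- (- \<theta>) \<in> uminus ` ?N" by (rule imageI)
      then show ?thesis by simp
    qed (use \<theta> in simp)
  qed (unfold reflect, auto)
  moreover have "card (?P \<union> uminus ` ?N) = card ?P + card (uminus ` ?N)"
    using pos_roots_binomial(1)[OF assms] N(1) by (intro card_Un_disjoint) auto
  moreover have "card (uminus ` ?N) = card ?N" by (intro card_image) simp
  ultimately show ?thesis using pos_roots_binomial(2)[OF assms] N(2) by simp
qed


section \<open>The geometry of Newton polygons\<close>

lemma valid_in_newton_region:
  assumes "z \<in> valid_indices F" "u \<ge> 0" "v \<ge> 0"
  shows "pt z + (u, v) \<in> newton_region F"
  unfolding newton_region_def using assms by (intro hull_inc) blast

lemma pt_in_newton_region: "z \<in> valid_indices F \<Longrightarrow> pt z \<in> newton_region F"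
  using valid_in_newton_region[of z F 0 0] by (simp flip: zero_prod_def)

lemma convex_newton_region: "convex (newton_region F)"
  by (simp add: newton_region_def)

lemma newton_region_subset_convex:
  assumes "convex K" "\<And>z u v. z \<in> valid_indices F \<Longrightarrow> u \<ge> 0 \<Longrightarrow> v \<ge> 0 \<Longrightarrow> pt z + (u, v) \<in> K"
  shows "newton_region F \<subseteq> K"
  unfolding newton_region_def using assms by (intro hull_minimal) auto

text \<open>Every translate of the generating set by a vector of the closed first quadrant stays inside it.\<close>

lemma newton_region_upward:
  assumes "p \<in> newton_region F" "fst p \<le> fst q" "snd p \<le> snd q"
  shows "q \<in> newton_region F"
proof -
  define w where "w = q - p"
  have "convex ((\<lambda>x. x - w) ` newton_region F)"
    using convex_translation_subtract_eq convex_newton_region by blast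
  then have "newton_region F \<subseteq> (\<lambda>x. x - w) ` newton_region F"
  proof (rule newton_region_subset_convex)
    fix z :: "nat \<times> nat" and u v :: real
    assume z: "z \<in> valid_indices F" "u \<ge> 0" "v \<ge> 0"
    have "pt z + (u + fst w, v + snd w) \<in> newton_region F"
      using z assms by (intro valid_in_newton_region) (auto simp: w_def)
    moreover have "pt z + (u, v) = pt z + (u + fst w, v + snd w) - w"
      by (cases w) simp
    ultimately show "pt z + (u, v) \<in> (\<lambda>x. x - w) ` newton_region F" by blast
  qed
  then have "p + w \<in> newton_region F" using assms(1) by force
  then show ?thesis by (simp add: w_def)
qed

text \<open>If \<open>q\<close> lies weakly below and to the left of an extreme point \<open>p\<close>, then \<open>2p - q\<close> is also in
  the region, and \<open>p\<close> is the midpoint of \<open>q\<close> and \<open>2p - q\<close>.\<close>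

lemma extreme_point_minimal:
  assumes ext: "p extreme_point_of newton_region F" and q: "q \<in> newton_region F"
    and le: "fst q \<le> fst p" "snd q \<le> snd p"
  shows "q = p"
proof (rule ccontr)
  assume ne: "q \<noteq> p"
  let ?r = "p + (p - q)"
  have "p \<in> newton_region F" using ext by (simp add: extreme_point_of_def)
  then have r: "?r \<in> newton_region F"
    by (rule newton_region_upward) (use le in auto)
  have "q \<noteq> ?r"
  proof
    assume "q = ?r"
    then have "2 *\<^sub>R q = 2 *\<^sub>R p" by (simp add: scaleR_2 algebra_simps)
    then show False using ne by simp
  qed
  moreover have "p = (1 - 1/2) *\<^sub>R q + (1/2) *\<^sub>R ?r"
    by (simp add: algebra_simps flip: scaleR_left_distrib)
  ultimately have "p \<in> open_segment q ?r"
    unfolding in_segment by (intro conjI exI[of _ "1/2"]) simp_all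
  then show False using ext q r by (auto simp: extreme_point_of_def)
qed

text \<open>A generator \<open>pt z' + (u, v)\<close> lies above and to the right of \<open>pt z'\<close>, so it is not extreme unless
  \<open>u = v = 0\<close>.\<close>

lemma extreme_point_valid:
  assumes "pt z extreme_point_of newton_region F"
  shows "z \<in> valid_indices F"
proof -
  obtain z' u v where z': "pt z = pt z' + (u, v)" "z' \<in> valid_indices F" "u \<ge> 0" "v \<ge> 0"
    using extreme_point_of_convex_hull[OF assms[unfolded newton_region_def]] by blast
  have "pt z' = pt z"
    using assms pt_in_newton_region[OF z'(2)]
    by (rule extreme_point_minimal) (use z' in auto)
  then have "z' = z" by (simp add: pt_def prod_eq_iff)
  then show ?thesis using z'(2) by simp
qed

text \<open>The points of the plane that do not precede \<open>pt z\<close> in the lexicographic order of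
  \<open>(\<alpha>u + \<beta>v, u)\<close> form a convex set that is stable under moving up or to the right. It
  contains the region if it contains all valid indices; and a strict convex combination of points that do not precede \<open>pt z\<close> equals \<open>pt z\<close>
  only if all of them are \<open>pt z\<close>. The tie-breaking by \<open>u\<close> allows \<open>\<alpha> = 0\<close>.\<close>

lemma lex_minimizer_extreme:
  fixes \<alpha> \<beta> :: real
  assumes z: "z \<in> valid_indices F" and \<alpha>: "\<alpha> \<ge> 0" and \<beta>: "\<beta> > 0"
    and min: "\<And>z'. z' \<in> valid_indices F \<Longrightarrow>
       \<alpha> * fst z + \<beta> * snd z < \<alpha> * fst z' + \<beta> * snd z' \<or>
       \<alpha> * fst z + \<beta> * snd z = \<alpha> * fst z' + \<beta> * snd z' \<and> fst z \<le> fst z'"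
  shows "pt z extreme_point_of newton_region F"
proof -
  define c where "c = \<alpha> * fst z + \<beta> * snd z"
  define f where "f p = \<alpha> * fst p + \<beta> * snd p" for p :: "real \<times> real"
  define i where "i = real (fst z)"
  define K where "K = {p. c < f p \<or> c = f p \<and> i \<le> fst p}"
  have f_comb: "f (x *\<^sub>R p + y *\<^sub>R q) = x * f p + y * f q" for p q x y
    by (simp add: f_def algebra_simps)
  have Kle: "c \<le> f p" if "p \<in> K" for p using that by (auto simp: K_def)
  have "convex K"
  proof (rule convexI)
    fix p q :: "real \<times> real" and x y :: real
    assume p: "p \<in> K" and q: "q \<in> K" and xy: "0 \<le> x" "0 \<le> y" "x + y = 1"
    have c: "c = x * c + y * c" and ii: "i = x * i + y * i"
      using xy(3) by (metis mult_1 distrib_right)+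
    show "x *\<^sub>R p + y *\<^sub>R q \<in> K"
    proof (cases "x = 0 \<or> y = 0")
      case True
      then show ?thesis using p q xy by auto
    next
      case False
      then have pos: "x > 0" "y > 0" using xy by auto
      show ?thesis
      proof (cases "f p = c \<and> f q = c")
        case True
        then have "i \<le> fst p" "i \<le> fst q" using p q by (auto simp: K_def)
        then have "i \<le> x * fst p + y * fst q"
          using pos ii by (smt (verit) mult_left_mono)
        then show ?thesis using True c by (simp add: K_def f_comb)
      next
        case False
        then have "x * c + y * c < x * f p + y * f q"
          using Kle[OF p] Kle[OF q] pos
          by (smt (verit) mult_left_mono mult_strict_left_mono)
        then show ?thesis using c by (simp add: K_def f_comb)
      qed
    qed
  qed
  then have sub: "newton_region F \<subseteq> K"
  proof (rule newton_region_subset_convex)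
    fix z' :: "nat \<times> nat" and u v :: real
    assume z': "z' \<in> valid_indices F" and uv: "u \<ge> 0" "v \<ge> 0"
    have "f (pt z' + (u, v)) = (\<alpha> * fst z' + \<beta> * snd z') + (\<alpha> * u + \<beta> * v)"
      by (simp add: f_def pt_def algebra_simps)
    moreover have "\<alpha> * u + \<beta> * v \<ge> 0" using uv \<alpha> \<beta> by simp
    ultimately show "pt z' + (u, v) \<in> K"
      using min[OF z'] uv by (auto simp: K_def c_def i_def pt_def)
  qed
  show ?thesis
    unfolding extreme_point_of_def
  proof (intro conjI ballI notI)
    show "pt z \<in> newton_region F" using z by (rule pt_in_newton_region)
  next
    fix p q assume p: "p \<in> newton_region F" and q: "q \<in> newton_region F"
      and "pt z \<in> open_segment p q"
    then obtain t where t: "p \<noteq> q" "0 < t" "t < 1" "pt z = (1 - t) *\<^sub>R p + t *\<^sub>R q"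
      by (auto simp: in_segment)
    have pK: "p \<in> K" and qK: "q \<in> K" using sub p q by auto
    have "f (pt z) = c" "fst (pt z) = i" by (simp_all add: f_def c_def pt_def i_def)
    moreover have "f (pt z) = (1 - t) * f p + t * f q" "fst (pt z) = (1 - t) * fst p + t * fst q"
      by (simp_all add: t(4) f_comb)
    ultimately have eqs: "(1 - t) * (f p - c) + t * (f q - c) = 0"
        "(1 - t) * (fst p - i) + t * (fst q - i) = 0"
      by (simp_all add: algebra_simps)
    have split0: "a = 0 \<and> b = 0" if "(1 - t) * a + t * b = 0" "a \<ge> 0" "b \<ge> 0" for a b
    proof -
      have "(1 - t) * a \<ge> 0" "t * b \<ge> 0" using that t by auto
      then have "(1 - t) * a = 0" "t * b = 0" using that by linarith+
      then show ?thesis using t by auto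
    qed
    have "f p = c" "f q = c" using split0[OF eqs(1)] Kle pK qK by auto
    moreover from this have "fst p = i" "fst q = i"
      using split0[OF eqs(2)] pK qK by (auto simp: K_def)
    ultimately have "f p = f q" "fst p = fst q" by (simp_all only:)
    then have "p = q" using \<beta> by (simp add: f_def prod_eq_iff)
    then show False using t(1) by simp
  qed
qed

text \<open>Natural coefficients suffice for the edges, whose directions are integral, and make the existence of
  a minimum a matter of well-ordering.\<close>

lemma ex_extreme_minimizer:
  fixes \<alpha> \<beta> :: nat
  assumes ne: "valid_indices F \<noteq> {}" and \<beta>: "\<beta> > 0"
  obtains z where "pt z extreme_point_of newton_region F"
    "\<And>z'. z' \<in> valid_indices F \<Longrightarrow> \<alpha> * fst z + \<beta> * snd z \<le> \<alpha> * fst z' + \<beta> * snd z'"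
proof -
  let ?f = "\<lambda>z. \<alpha> * fst z + \<beta> * snd z"
  obtain z0 where z0: "z0 \<in> valid_indices F" "\<And>z'. z' \<in> valid_indices F \<Longrightarrow> ?f z0 \<le> ?f z'"
    using ne ex_has_least_nat[of "\<lambda>z. z \<in> valid_indices F" _ ?f] by (metis all_not_in_conv)
  obtain z where z: "z \<in> valid_indices F" "?f z = ?f z0"
      "\<And>z'. z' \<in> valid_indices F \<Longrightarrow> ?f z' = ?f z0 \<Longrightarrow> fst z \<le> fst z'"
    using z0(1) ex_has_least_nat[of "\<lambda>z. z \<in> valid_indices F \<and> ?f z = ?f z0" z0 fst] by metis
  have "pt z extreme_point_of newton_region F"
  proof (rule lex_minimizer_extreme[of z F "real \<alpha>" "real \<beta>"])
    fix z' assume z': "z' \<in> valid_indices F"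
    have "?f z \<le> ?f z'" using z0(2)[OF z'] z(2) by simp
    moreover have "fst z \<le> fst z'" if "?f z = ?f z'" using z(2) z(3)[OF z'] that by simp
    ultimately have "?f z < ?f z' \<or> ?f z = ?f z' \<and> fst z \<le> fst z'"
      by (metis le_neq_implies_less)
    then have "real (?f z) < real (?f z') \<or> real (?f z) = real (?f z') \<and> fst z \<le> fst z'"
      unfolding of_nat_less_iff of_nat_eq_iff .
    then show "real \<alpha> * fst z + real \<beta> * snd z < real \<alpha> * fst z' + real \<beta> * snd z' \<or>
       real \<alpha> * fst z + real \<beta> * snd z = real \<alpha> * fst z' + real \<beta> * snd z' \<and> fst z \<le> fst z'"
      by simp
  qed (use z \<beta> in auto)
  moreover have "?f z \<le> ?f z'" if "z' \<in> valid_indices F" for z'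
    using z0(2)[OF that] z(2) by simp
  ultimately show ?thesis using that by blast
qed

lemma extreme_pt_minimal:
  assumes "pt z extreme_point_of newton_region F" "pt z' extreme_point_of newton_region F"
    and "fst z' \<le> fst z" "snd z' \<le> snd z"
  shows "z' = z"
proof -
  have "pt z' = pt z"
    using assms by (intro extreme_point_minimal[of _ F]) (auto simp: extreme_point_of_def pt_def)
  then show ?thesis by (simp add: pt_def prod_eq_iff)
qed

text \<open>Sorting by a key that is injective on the set in question. Stated for the class, these facts concern
  the overloaded sorting function rather than that of an abstract order.\<close>

context linorder
begin

lemma set_sorted_key_list:
  assumes "inj_on f A" "finite A"
  shows "set (sorted_key_list_of_set f A) = A"
proof -
  interpret folding_insort_key "(\<le>)" "(<)" A f by unfold_locales (rule assms)
  show ?thesis using assms by simp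
qed

lemma strict_sorted_key_list:
  assumes "inj_on f A"
  shows "sorted_wrt (<) (map f (sorted_key_list_of_set f A))"
proof -
  interpret folding_insort_key "(\<le>)" "(<)" A f by unfold_locales (rule assms)
  show ?thesis by simp
qed

end

text \<open>By minimality, the vertices form an antichain in the plane lattice: relative to a fixed vertex, each
  one has a smaller abscissa or a smaller ordinate, or is that vertex, and either coordinate determines
  it.\<close>

lemma finite_extreme_points: "finite {z. pt z extreme_point_of newton_region F}"
proof (cases "{z. pt z extreme_point_of newton_region F} = {}")
  case False
  let ?E = "{z. pt z extreme_point_of newton_region F}"
  obtain z0 where z0: "z0 \<in> ?E" using False by blast
  have "inj_on fst ?E" "inj_on snd ?E"
    using extreme_pt_minimal by (metis (mono_tags, lifting) inj_onI mem_Collect_eq nle_le order_refl)+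
  then have "inj_on fst {z \<in> ?E. fst z \<le> fst z0}" "inj_on snd {z \<in> ?E. snd z \<le> snd z0}"
    by (auto elim!: inj_on_subset)
  moreover have "fst ` {z \<in> ?E. fst z \<le> fst z0} \<subseteq> {..fst z0}" "snd ` {z \<in> ?E. snd z \<le> snd z0} \<subseteq> {..snd z0}"
    by auto
  ultimately have "finite {z \<in> ?E. fst z \<le> fst z0}" "finite {z \<in> ?E. snd z \<le> snd z0}"
    using inj_on_finite finite_atMost by blast+
  moreover have "fst z \<le> fst z0 \<or> snd z \<le> snd z0" if "z \<in> ?E" for z
    using extreme_pt_minimal[of z F z0] that z0 by force
  then have "?E \<subseteq> {z \<in> ?E. fst z \<le> fst z0} \<union> {z \<in> ?E. snd z \<le> snd z0}"
    by blast
  ultimately show ?thesis using finite_subset by blast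
next
  case True
  then show ?thesis by (simp only: finite.emptyI)
qed

lemma
  shows set_vertices: "set (vertices F) = {z. pt z extreme_point_of newton_region F}"
    and sorted_vertices: "sorted_wrt (<) (map fst (vertices F))"
proof -
  let ?E = "{z. pt z extreme_point_of newton_region F}"
  have inj: "inj_on fst ?E"
    using extreme_pt_minimal by (metis (mono_tags, lifting) inj_onI mem_Collect_eq nle_le order_refl)
  show "set (vertices F) = ?E"
    unfolding vertices_def by (rule set_sorted_key_list[OF inj finite_extreme_points])
  show "sorted_wrt (<) (map fst (vertices F))"
    unfolding vertices_def by (rule strict_sorted_key_list[OF inj])
qed

lemma vertices_nonempty: "valid_indices F \<noteq> {} \<Longrightarrow> vertices F \<noteq> []"
  using ex_extreme_minimizer[of F 1 1] set_vertices[of F] by force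

lemma length_vertices: "valid_indices F \<noteq> {} \<Longrightarrow> length (vertices F) = Suc (num_edges F)"
  using vertices_nonempty[of F] by (cases "vertices F") (auto simp: num_edges_def)

lemma vertex_extreme:
  assumes "valid_indices F \<noteq> {}" "k \<le> num_edges F"
  shows "pt (vertex F k) extreme_point_of newton_region F"
  using assms set_vertices[of F] length_vertices[of F] nth_mem[of k "vertices F"] by auto

lemma vertex_valid: "valid_indices F \<noteq> {} \<Longrightarrow> k \<le> num_edges F \<Longrightarrow> vertex F k \<in> valid_indices F"
  by (intro extreme_point_valid vertex_extreme)

lemma extreme_is_vertex:
  assumes "valid_indices F \<noteq> {}" "pt z extreme_point_of newton_region F"
  obtains k where "k \<le> num_edges F" "z = vertex F k"
  using assms set_vertices[of F] length_vertices[of F]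
  by (metis (mono_tags, lifting) in_set_conv_nth less_Suc_eq_le mem_Collect_eq)

lemma vertex_strict_mono:
  assumes ne: "valid_indices F \<noteq> {}" and kl: "k < l" "l \<le> num_edges F"
  shows "fst (vertex F k) < fst (vertex F l)" "snd (vertex F l) < snd (vertex F k)"
proof -
  show less: "fst (vertex F k) < fst (vertex F l)"
    using sorted_vertices[of F] length_vertices[OF ne] kl by (simp add: sorted_wrt_iff_nth_less)
  show "snd (vertex F l) < snd (vertex F k)"
    using extreme_pt_minimal[of "vertex F l" F "vertex F k"] vertex_extreme[OF ne] less kl
    by fastforce
qed

text \<open>If the middle vertex were on or above the chord of the other two, the point of the chord with
  the same abscissa would contradict its minimality or its extremality.\<close>

lemma vertices_strictly_convex:
  assumes ne: "valid_indices F \<noteq> {}" and klm: "k < l" "l < m" "m \<le> num_edges F"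
  shows "(real (snd (vertex F l)) - real (snd (vertex F k))) * (real (fst (vertex F m)) - real (fst (vertex F l)))
       < (real (snd (vertex F m)) - real (snd (vertex F l))) * (real (fst (vertex F l)) - real (fst (vertex F k)))"
proof (rule ccontr)
  assume not: "\<not> ?thesis"
  define A B C where ABC: "A = pt (vertex F k)" "B = pt (vertex F l)" "C = pt (vertex F m)"
  have ord: "fst A < fst B" "fst B < fst C"
    using vertex_strict_mono[OF ne] klm by (simp_all add: ABC pt_def)
  have above: "(snd B - snd A) * (fst C - fst B) \<ge> (snd C - snd B) * (fst B - fst A)"
    using not by (simp add: ABC pt_def)
  define t where "t = (fst B - fst A) / (fst C - fst A)"
  have t: "0 < t" "t < 1" using ord by (simp_all add: t_def)
  have tt: "t * (fst C - fst A) = fst B - fst A" using ord by (simp add: t_def)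
  define P where "P = (1 - t) *\<^sub>R A + t *\<^sub>R C"
  have ext: "A \<in> newton_region F" "B extreme_point_of newton_region F" "C \<in> newton_region F"
    using vertex_extreme[OF ne] klm by (auto simp: ABC extreme_point_of_def)
  have P: "P \<in> newton_region F"
    unfolding P_def using ext t by (intro convexD[OF convex_newton_region]) auto
  have fP: "fst P = fst B" using tt by (simp add: P_def algebra_simps)
  have "(fst C - fst A) * (snd P - snd A) = (t * (fst C - fst A)) * (snd C - snd A)"
    by (simp add: P_def algebra_simps)
  then have "(fst C - fst A) * (snd P - snd A) \<le> (fst C - fst A) * (snd B - snd A)"
    unfolding tt using above by (simp add: algebra_simps)
  then have "snd P \<le> snd B" using ord by (simp add: mult_le_cancel_left)
  then have "P = B" using extreme_point_minimal[OF ext(2) P] fP by simp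
  moreover have "P \<in> open_segment A C"
    using ord t by (auto simp: in_segment P_def)
  ultimately show False using ext by (auto simp: extreme_point_of_def)
qed

lemma edge_slope_strict_mono:
  assumes ne: "valid_indices F \<noteq> {}" and k: "1 \<le> k" and kl: "k < l" and l: "l \<le> num_edges F"
  shows "edge_slope F k < edge_slope F l"
  using kl l
proof (induction l)
  case (Suc l)
  have kl: "1 \<le> l" "l \<le> num_edges F" using k Suc.prems by auto
  have less: "edge_slope F l < edge_slope F (Suc l)"
    using vertices_strictly_convex[OF ne, of "l - 1" l "Suc l"]
      vertex_strict_mono(1)[OF ne, of "l - 1" l] vertex_strict_mono(1)[OF ne, of l "Suc l"] kl Suc.prems
    unfolding edge_slope_def by (simp add: divide_less_eq less_divide_eq mult.commute)
  then show ?case using Suc kl by (cases "k = l") auto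
qed simp

text \<open>The functional that is constant on an edge attains its minimum over the valid indices at some
  vertex, and by strict convexity it is smallest at the two ends of the edge.\<close>

lemma edge_supports_region:
  fixes F k
  defines "i \<equiv> fst (vertex F (k - 1))" and "j \<equiv> snd (vertex F (k - 1))"
    and "i' \<equiv> fst (vertex F k)" and "j' \<equiv> snd (vertex F k)"
  defines "f \<equiv> \<lambda>p. (real j - real j') * fst p + (real i' - real i) * snd p"
  assumes ne: "valid_indices F \<noteq> {}" and k: "1 \<le> k" "k \<le> num_edges F"
    and p: "p \<in> newton_region F"
  shows "f (pt (vertex F k)) \<le> f p" "f (pt (vertex F (k - 1))) = f (pt (vertex F k))"
    "i < i'" "j' < j"
proof -
  show eq: "f (pt (vertex F (k - 1))) = f (pt (vertex F k))"
    by (simp add: f_def pt_def i_def j_def i'_def j'_def algebra_simps)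
  show ij: "i < i'" "j' < j"
    unfolding i_def j_def i'_def j'_def using k by (intro vertex_strict_mono[OF ne]; simp)+
  have at_vertex: "f (pt (vertex F k)) \<le> f (pt (vertex F l))" if l: "l \<le> num_edges F" for l
  proof -
    consider "l < k - 1" | "l = k - 1" | "l = k" | "k < l" by linarith
    then show ?thesis
    proof cases
      case 1
      have "f (pt (vertex F (k - 1))) \<le> f (pt (vertex F l))"
        using vertices_strictly_convex[OF ne 1, of k] k
        by (simp add: f_def pt_def i_def j_def i'_def j'_def algebra_simps)
      then show ?thesis using eq by simp
    next
      case 4
      show ?thesis
        using vertices_strictly_convex[OF ne _ 4 l, of "k - 1"] k
        by (simp add: f_def pt_def i_def j_def i'_def j'_def algebra_simps)
    next
      case 2
      then show ?thesis by (metis eq order_refl)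
    qed simp
  qed
  obtain w where w: "pt w extreme_point_of newton_region F"
    "\<And>z. z \<in> valid_indices F \<Longrightarrow> (j - j') * fst w + (i' - i) * snd w \<le> (j - j') * fst z + (i' - i) * snd z"
    using ex_extreme_minimizer[OF ne, of "i' - i" "j - j'"] ij by auto
  obtain l where l: "l \<le> num_edges F" "w = vertex F l"
    using extreme_is_vertex[OF ne w(1)] .
  have f_nat: "f (pt z) = real ((j - j') * fst z + (i' - i) * snd z)" for z
    using ij by (simp add: f_def pt_def of_nat_diff)
  have valid: "f (pt (vertex F k)) \<le> f (pt z)" if "z \<in> valid_indices F" for z
  proof -
    have "f (pt w) \<le> f (pt z)" unfolding f_nat using w(2)[OF that] of_nat_le_iff by blast
    then show ?thesis using at_vertex[OF l(1)] l(2) by simp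
  qed
  have half_plane: "{p. f (pt (vertex F k)) \<le> f p} = {p. (real j - real j', real i' - real i) \<bullet> p \<ge> f (pt (vertex F k))}"
    by (auto simp: f_def inner_prod_def)
  have "newton_region F \<subseteq> {p. f (pt (vertex F k)) \<le> f p}"
  proof (rule newton_region_subset_convex)
    show "convex {p. f (pt (vertex F k)) \<le> f p}"
      unfolding half_plane by (rule convex_halfspace_ge)
  next
    fix z :: "nat \<times> nat" and u v :: real
    assume z: "z \<in> valid_indices F" "u \<ge> 0" "v \<ge> 0"
    have "f (pt z + (u, v)) = f (pt z) + ((real j - real j') * u + (real i' - real i) * v)"
      by (simp add: f_def algebra_simps)
    moreover have "(real j - real j') * u + (real i' - real i) * v \<ge> 0" using ij z by simp
    ultimately show "pt z + (u, v) \<in> {p. f (pt (vertex F k)) \<le> f p}" using valid[OF z(1)] by simp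
  qed
  then show "f (pt (vertex F k)) \<le> f p" using p by blast
qed

text \<open>The functional of the supporting line has positive coefficients and is constant on the edge, hence no
  point of the region lies below, or to the left of, a point of the edge.\<close>

lemma edge_subset_newton_polygon:
  assumes ne: "valid_indices F \<noteq> {}" and k: "1 \<le> k" "k \<le> num_edges F"
  shows "edge F k \<subseteq> newton_polygon F"
proof
  define i j i' j' where ij: "i = fst (vertex F (k - 1))" "j = snd (vertex F (k - 1))"
    "i' = fst (vertex F k)" "j' = snd (vertex F k)"
  define f where "f p = (real j - real j') * fst p + (real i' - real i) * snd p" for p :: "real \<times> real"
  note sup = edge_supports_region[OF ne k, folded ij, folded f_def]
  have ends: "pt (vertex F (k - 1)) \<in> newton_region F" "pt (vertex F k) \<in> newton_region F"
    using k by (intro pt_in_newton_region vertex_valid[OF ne]; simp)+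
  fix p assume "p \<in> edge F k"
  then obtain t where t: "0 \<le> t" "t \<le> 1" "p = (1 - t) *\<^sub>R pt (vertex F (k - 1)) + t *\<^sub>R pt (vertex F k)"
    unfolding edge_def in_segment by blast
  have pR: "p \<in> newton_region F"
    unfolding t(3) using ends t by (intro convexD[OF convex_newton_region]) auto
  have "f p = (1 - t) * f (pt (vertex F (k - 1))) + t * f (pt (vertex F k))"
    by (simp add: t(3) f_def algebra_simps)
  then have fp: "f p = f (pt (vertex F k))"
    using sup(2)[OF pR] by (simp add: algebra_simps)
  have min: "f p \<le> f q" if "q \<in> newton_region F" for q using sup(1)[OF that] fp by simp
  have ij_less: "i < i'" "j' < j" using sup(3,4)[OF pR] by auto
  have below: "(fst p, v) \<notin> newton_region F" if "v < snd p" for v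
  proof
    assume "(fst p, v) \<in> newton_region F"
    then have "(real i' - real i) * snd p \<le> (real i' - real i) * v"
      using min[of "(fst p, v)"] by (simp add: f_def)
    then show False using that ij_less by simp
  qed
  have left: "(u, snd p) \<notin> newton_region F" if "u < fst p" for u
  proof
    assume "(u, snd p) \<in> newton_region F"
    then have "(real j - real j') * fst p \<le> (real j - real j') * u"
      using min[of "(u, snd p)"] by (simp add: f_def)
    then show False using that ij_less by simp
  qed
  have "p \<notin> interior (newton_region F)"
  proof
    assume "p \<in> interior (newton_region F)"
    then obtain e where e: "e > 0" "ball p e \<subseteq> newton_region F"
      by (meson mem_interior)
    have "(fst p, snd p - e/2) \<in> ball p e"
      using e(1) by (cases p) (simp add: dist_Pair_Pair dist_real_def)
    then show False using below[of "snd p - e/2"] e by auto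
  qed
  then have "p \<in> frontier (newton_region F)"
    using pR closure_subset by (auto simp: frontier_def)
  then show "p \<in> newton_polygon F"
    using below left by (cases p) (auto simp: newton_polygon_def)
qed

text \<open>As the slopes increase strictly, exactly one edge has this slope, and no vertex has it strictly
  between the slopes of its two adjacent edges.\<close>

lemma component_edge_slope:
  assumes ne: "valid_indices F \<noteq> {}" and k: "1 \<le> k" "k \<le> num_edges F"
  shows "component F (edge_slope F k) = edge F k"
proof -
  have mono: "edge_slope F l < edge_slope F l'" if "1 \<le> l" "l < l'" "l' \<le> num_edges F" for l l'
    using edge_slope_strict_mono[OF ne] that by blast
  have self: "{l \<in> {1..num_edges F}. edge_slope F k = edge_slope F l} = {k}"
    using k mono by (auto; metis less_irrefl linorder_neqE_nat)
  have none: "{l \<in> {0..num_edges F}. zeta_minus F l < ereal (edge_slope F k) \<and>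
      ereal (edge_slope F k) < zeta_plus F l} = {}"
  proof -
    have False if l: "l \<le> num_edges F" "zeta F l < ereal (edge_slope F k)"
      "ereal (edge_slope F k) < zeta F (Suc l)" for l
    proof (cases "k \<le> l")
      case True
      then have "edge_slope F k \<le> edge_slope F l" using mono[of k l] k l by (cases "k = l") auto
      then show False using l True k by (auto simp: zeta_def)
    next
      case False
      then have "edge_slope F (Suc l) \<le> edge_slope F k" using mono[of "Suc l" k] k by (cases "Suc l = k") auto
      then show False using l False k by (auto simp: zeta_def)
    qed
    then show ?thesis by (auto simp: zeta_minus_def zeta_plus_def)
  qed
  show ?thesis unfolding component_def self none by simp
qed

text \<open>A valid index on the edge lies on the polygon, so it is a vertex by hypothesis; and an extreme point
  of the region is not interior to a segment of the region.\<close>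

lemma comp_poly_binomial:
  assumes ne: "valid_indices F \<noteq> {}" and k: "1 \<le> k" "k \<le> num_edges F"
    and T: "newton_polygon F \<inter> pt ` valid_indices F = pt ` set (vertices F)"
  shows "comp_poly (edge_slope F k) F \<theta> =
      (case vertex F (k - 1) of (i, j) \<Rightarrow> coef F i j * \<theta> ^ j) +
      (case vertex F k of (i, j) \<Rightarrow> coef F i j * \<theta> ^ j)"
proof -
  let ?a = "vertex F (k - 1)" and ?b = "vertex F k"
  have ab: "?a \<in> valid_indices F" "?b \<in> valid_indices F"
    using k by (intro vertex_valid[OF ne]; simp)+
  have distinct: "?a \<noteq> ?b" using vertex_strict_mono[OF ne, of "k - 1" k] k by fastforce
  have ends: "pt ?a \<in> component F (edge_slope F k)" "pt ?b \<in> component F (edge_slope F k)"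
    unfolding component_edge_slope[OF ne k] edge_def by simp_all
  have indices: "{z \<in> valid_indices F. pt z \<in> component F (edge_slope F k)} = {?a, ?b}"
  proof (intro equalityI subsetI)
    fix z assume "z \<in> {z \<in> valid_indices F. pt z \<in> component F (edge_slope F k)}"
    then have z: "z \<in> valid_indices F" "pt z \<in> edge F k"
      by (auto simp: component_edge_slope[OF ne k])
    then have "pt z \<in> pt ` set (vertices F)"
      using T edge_subset_newton_polygon[OF ne k] by blast
    then have "pt z extreme_point_of newton_region F"
      using set_vertices by auto
    then have "pt z \<notin> open_segment (pt ?a) (pt ?b)"
      using ab pt_in_newton_region by (auto simp: extreme_point_of_def)
    then have "pt z = pt ?a \<or> pt z = pt ?b"
      using z(2) by (auto simp: edge_def open_segment_def)
    then show "z \<in> {?a, ?b}" by (auto simp: pt_def prod_eq_iff)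
  qed (use ab ends in blast)
  show ?thesis unfolding comp_poly_def indices using distinct by simp
qed

text \<open>The functional \<open>(u, v) \<mapsto> v\<close> attains its minimum over the valid indices at a vertex, and the
  ordinates of the vertices decrease.\<close>

lemma last_ordinate_le:
  assumes "(i, j) \<in> valid_indices F"
  shows "last_ordinate F \<le> j"
proof -
  have ne: "valid_indices F \<noteq> {}" using assms by blast
  obtain z where z: "pt z extreme_point_of newton_region F"
      "\<And>z'. z' \<in> valid_indices F \<Longrightarrow> 0 * fst z + 1 * snd z \<le> 0 * fst z' + 1 * snd z'"
    using ex_extreme_minimizer[OF ne, of 1 0] by auto
  obtain k where k: "k \<le> num_edges F" "z = vertex F k" using extreme_is_vertex[OF ne z(1)] .
  have "last_ordinate F \<le> snd z"
    using vertex_strict_mono(2)[OF ne, of k "num_edges F"] k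
    by (cases "k = num_edges F") (auto simp: last_ordinate_def)
  then show ?thesis using z(2)[OF assms] by simp
qed


section \<open>Counting roots along the polygon\<close>

text \<open>The sign changes inside the two sequences are summed edge by edge. The parity term comes from the
  junction, where \<open>a\<close> is followed by \<open>(- 1) ^ j * a\<close> for the last vertex \<open>(i, j)\<close> with
  coefficient \<open>a\<close>.\<close>

lemma sign_changes_seqs:
  assumes ne: "valid_indices F \<noteq> {}"
  shows "sign_changes (A_seq F @ Aj_seq F) = of_bool (odd (last_ordinate F)) +
    (\<Sum>k\<in>{1..num_edges F}. case (vertex F (k - 1), vertex F k) of ((i, j), (i', j')) \<Rightarrow>
        of_bool (coef F i j * coef F i' j' < 0) +
        of_bool (((- 1) ^ j * coef F i j) * ((- 1) ^ j' * coef F i' j') < 0))"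
proof -
  let ?vs = "vertices F"
  define a where "a = (\<lambda>(i, j). coef F i j)"
  define b where "b = (\<lambda>(i, j). (- 1) ^ j * coef F i j)"
  have vs: "?vs \<noteq> []" "length ?vs = Suc (num_edges F)"
    using vertices_nonempty[OF ne] length_vertices[OF ne] by auto
  have last: "last ?vs = vertex F (num_edges F)" using vs by (simp add: last_conv_nth)
  obtain i j where "vertex F (num_edges F) = (i, j)" by fastforce
  then have ij: "last ?vs = (i, j)" "vertex F (num_edges F) = (i, j)" using last by simp_all
  have j: "last_ordinate F = j" using ij by (simp add: last_ordinate_def)
  have "coef F i j \<noteq> 0"
    using vertex_valid[OF ne, of "num_edges F"] ij by (simp add: valid_indices_def)
  then have "coef F i j * coef F i j > 0" using not_real_square_gt_zero by blast
  then have junction: "(a (last ?vs) * b (last ?vs) < 0) = odd j"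
    unfolding ij(1) a_def b_def by (cases "even j") (simp_all add: not_less)
  have sum: "sign_changes (map c ?vs) = (\<Sum>k\<in>{1..num_edges F}. of_bool (c (vertex F (k - 1)) * c (vertex F k) < 0))"
    for c :: "nat \<times> nat \<Rightarrow> real"
  proof -
    have "sign_changes (map c ?vs) = (\<Sum>k<num_edges F. of_bool (c (vertex F k) * c (vertex F (k + 1)) < 0))"
      unfolding sign_changes_conv_sum using vs by (intro sum.cong) auto
    also have "\<dots> = (\<Sum>k\<in>{1..num_edges F}. of_bool (c (vertex F (k - 1)) * c (vertex F k) < 0))"
      by (rule sum.reindex_bij_witness[of _ "\<lambda>k. k - 1" Suc]) auto
    finally show ?thesis .
  qed
  have "sign_changes (A_seq F @ Aj_seq F) = sign_changes (map a ?vs @ rev (map b ?vs))"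
    by (simp add: A_seq_def Aj_seq_def a_def b_def)
  also have "\<dots> = sign_changes (map a ?vs) + of_bool (a (last ?vs) * b (last ?vs) < 0) + sign_changes (map b ?vs)"
    using vs by (subst sign_changes_append) (simp_all add: last_map hd_rev)
  also note junction
  finally show ?thesis
    unfolding sum j a_def b_def case_prod_unfold prod.sel sum.distrib by linarith
qed

lemma chi_eq_sum_binomial_roots:
  assumes ne: "valid_indices F \<noteq> {}"
    and T: "newton_polygon F \<inter> pt ` valid_indices F = pt ` set (vertices F)"
  shows "chi F = (\<Sum>k\<in>{1..num_edges F}. case (vertex F (k - 1), vertex F k) of ((i, j), (i', j')) \<Rightarrow>
        of_bool (coef F i j * coef F i' j' < 0) +
        of_bool (((- 1) ^ j * coef F i j) * ((- 1) ^ j' * coef F i' j') < 0))"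
proof -
  have "inj_on (edge_slope F) {1..num_edges F}"
    by (rule linorder_inj_onI) (use edge_slope_strict_mono[OF ne] in force)+
  then have "chi F = (\<Sum>k\<in>{1..num_edges F}. card {\<theta>. \<theta> \<noteq> 0 \<and> comp_poly (edge_slope F k) F \<theta> = 0})"
    unfolding chi_def slopes_def by (simp add: sum.reindex)
  also have "\<dots> = (\<Sum>k\<in>{1..num_edges F}. case (vertex F (k - 1), vertex F k) of ((i, j), (i', j')) \<Rightarrow>
        of_bool (coef F i j * coef F i' j' < 0) +
        of_bool (((- 1) ^ j * coef F i j) * ((- 1) ^ j' * coef F i' j') < 0))"
  proof (intro sum.cong refl)
    fix k assume "k \<in> {1..num_edges F}"
    then have k: "1 \<le> k" "k \<le> num_edges F" by auto
    obtain i j i' j' where v: "vertex F (k - 1) = (i, j)" "vertex F k = (i', j')"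
      by fastforce
    have nz: "coef F i j \<noteq> 0" "coef F i' j' \<noteq> 0"
      using vertex_valid[OF ne, of "k - 1"] vertex_valid[OF ne, of k] k v
      by (auto simp: valid_indices_def)
    have less: "j' < j" using vertex_strict_mono(2)[OF ne, of "k - 1" k] k v by simp
    show "card {\<theta>. \<theta> \<noteq> 0 \<and> comp_poly (edge_slope F k) F \<theta> = 0} =
        (case (vertex F (k - 1), vertex F k) of ((i, j), (i', j')) \<Rightarrow>
        of_bool (coef F i j * coef F i' j' < 0) +
        of_bool (((- 1) ^ j * coef F i j) * ((- 1) ^ j' * coef F i' j') < 0))"
      unfolding comp_poly_binomial[OF ne k T] v prod.case by (rule card_nonzero_roots_binomial[OF nz less])
  qed
  finally show ?thesis .
qed

text \<open>\<open>N_num\<close> exceeds \<open>chi\<close> by one if the last ordinate is positive, the sign changes exceed it by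
  one if the last ordinate is odd.\<close>

lemma N_num_eq_sign_changes:
  assumes ne: "valid_indices F \<noteq> {}"
    and T: "newton_polygon F \<inter> pt ` valid_indices F = pt ` set (vertices F)"
    and last: "last_ordinate F = 0 \<or> odd (last_ordinate F)"
  shows "N_num F = sign_changes (A_seq F @ Aj_seq F)"
  unfolding N_num_def sign_changes_seqs[OF ne] chi_eq_sum_binomial_roots[OF ne T]
  using last by auto


section \<open>Power series in polar coordinates\<close>

text \<open>The least such \<open>M\<close> is the weighted \<open>\<ell>\<^sup>1\<close> norm \<open>\<Sum>\<bar>c\<^sub>n\<bar>t\<^sup>n\<close> of the Taylor
  coefficients of \<open>f\<close>. This norm is submultiplicative, so bounds for \<open>cos\<close> and \<open>sin\<close> propagate to
  every polynomial in them.\<close>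

definition powser_bound :: "real \<Rightarrow> (real \<Rightarrow> real) \<Rightarrow> real \<Rightarrow> bool" where
  "powser_bound t f M \<longleftrightarrow>
     (\<exists>c. (\<forall>x. \<bar>x\<bar> \<le> t \<longrightarrow> (\<lambda>n. c n * x ^ n) sums f x) \<and>
          summable (\<lambda>n. \<bar>c n\<bar> * t ^ n) \<and> (\<Sum>n. \<bar>c n\<bar> * t ^ n) \<le> M)"

lemma powser_boundI:
  assumes "\<And>x. \<bar>x\<bar> \<le> t \<Longrightarrow> (\<lambda>n. c n * x ^ n) sums f x"
    and "summable (\<lambda>n. \<bar>c n\<bar> * t ^ n)" "(\<Sum>n. \<bar>c n\<bar> * t ^ n) \<le> M"
  shows "powser_bound t f M"
  using assms unfolding powser_bound_def by blast

lemma powser_bound_nonneg: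
  assumes "powser_bound t f M" "t \<ge> 0"
  shows "M \<ge> 0"
proof -
  obtain c where "summable (\<lambda>n. \<bar>c n\<bar> * t ^ n)" "(\<Sum>n. \<bar>c n\<bar> * t ^ n) \<le> M"
    using assms unfolding powser_bound_def by blast
  moreover from this(1) have "0 \<le> (\<Sum>n. \<bar>c n\<bar> * t ^ n)" using assms by (intro suminf_nonneg) auto
  ultimately show ?thesis by linarith
qed

lemma powser_bound_mono: "powser_bound t f M \<Longrightarrow> M \<le> N \<Longrightarrow> powser_bound t f N"
  unfolding powser_bound_def by force

lemma powser_bound_const: "powser_bound t (\<lambda>_. k) \<bar>k\<bar>"
proof (rule powser_boundI)
  have *: "(\<lambda>n. (if n = 0 then a else 0) * x ^ n) sums a" for x a :: real
    using sums_If_finite_set[of "{0::nat}" "\<lambda>n. a * x ^ n"]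
    by (simp add: if_distrib[of "\<lambda>u. u * _"] cong: if_cong)
  show "(\<lambda>n. (if n = 0 then k else 0) * x ^ n) sums k" for x by (rule *)
  have "(\<lambda>n. \<bar>if n = 0 then k else 0\<bar> * t ^ n) sums \<bar>k\<bar>"
    using *[of "\<bar>k\<bar>" t] by (simp add: if_distrib cong: if_cong)
  then show "summable (\<lambda>n. \<bar>if n = 0 then k else 0\<bar> * t ^ n)"
      "(\<Sum>n. \<bar>if n = 0 then k else 0\<bar> * t ^ n) \<le> \<bar>k\<bar>"
    by (simp_all add: sums_iff)
qed

lemma powser_bound_add:
  assumes "powser_bound t f M" "powser_bound t g N" "t \<ge> 0"
  shows "powser_bound t (\<lambda>x. f x + g x) (M + N)"
proof -
  obtain c where c: "\<And>x. \<bar>x\<bar> \<le> t \<Longrightarrow> (\<lambda>n. c n * x ^ n) sums f x"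
      "summable (\<lambda>n. \<bar>c n\<bar> * t ^ n)" "(\<Sum>n. \<bar>c n\<bar> * t ^ n) \<le> M"
    using assms(1) unfolding powser_bound_def by blast
  obtain d where d: "\<And>x. \<bar>x\<bar> \<le> t \<Longrightarrow> (\<lambda>n. d n * x ^ n) sums g x"
      "summable (\<lambda>n. \<bar>d n\<bar> * t ^ n)" "(\<Sum>n. \<bar>d n\<bar> * t ^ n) \<le> N"
    using assms(2) unfolding powser_bound_def by blast
  have le: "\<bar>c n + d n\<bar> * t ^ n \<le> \<bar>c n\<bar> * t ^ n + \<bar>d n\<bar> * t ^ n" for n
    using assms(3) mult_right_mono[OF abs_triangle_ineq[of "c n" "d n"], of "t ^ n"]
    by (simp add: distrib_right)
  have sm: "summable (\<lambda>n. \<bar>c n + d n\<bar> * t ^ n)"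
    by (rule summable_comparison_test[OF _ summable_add[OF c(2) d(2)]]) (use le assms(3) in auto)
  show ?thesis
  proof (rule powser_boundI[where c = "\<lambda>n. c n + d n"])
    show "(\<lambda>n. (c n + d n) * x ^ n) sums (f x + g x)" if "\<bar>x\<bar> \<le> t" for x
      using sums_add[OF c(1) d(1)] that by (simp add: distrib_right)
    show "(\<Sum>n. \<bar>c n + d n\<bar> * t ^ n) \<le> M + N"
      using suminf_le[OF le sm summable_add[OF c(2) d(2)]] suminf_add[OF c(2) d(2)] c(3) d(3)
      by linarith
  qed (rule sm)
qed

lemma powser_bound_mult:
  assumes "powser_bound t f M" "powser_bound t g N" "t \<ge> 0"
  shows "powser_bound t (\<lambda>x. f x * g x) (M * N)"
proof -
  obtain c where c: "\<And>x. \<bar>x\<bar> \<le> t \<Longrightarrow> (\<lambda>n. c n * x ^ n) sums f x"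
      "summable (\<lambda>n. \<bar>c n\<bar> * t ^ n)" "(\<Sum>n. \<bar>c n\<bar> * t ^ n) \<le> M"
    using assms(1) unfolding powser_bound_def by blast
  obtain d where d: "\<And>x. \<bar>x\<bar> \<le> t \<Longrightarrow> (\<lambda>n. d n * x ^ n) sums g x"
      "summable (\<lambda>n. \<bar>d n\<bar> * t ^ n)" "(\<Sum>n. \<bar>d n\<bar> * t ^ n) \<le> N"
    using assms(2) unfolding powser_bound_def by blast
  have smaller: "summable (\<lambda>n. norm (a n * x ^ n))"
    if "summable (\<lambda>n. \<bar>a n\<bar> * t ^ n)" "\<bar>x\<bar> \<le> t" for a x
  proof (rule summable_comparison_test[OF _ that(1)], intro exI allI impI)
    fix n :: nat assume "0 \<le> n"
    show "norm (norm (a n * x ^ n)) \<le> \<bar>a n\<bar> * t ^ n"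
      using that(2) by (simp add: abs_mult power_abs mult_left_mono power_mono)
  qed
  define e where "e n = (\<Sum>i\<le>n. c i * d (n - i))" for n
  have conv: "(\<Sum>i\<le>n. (a i * x ^ i) * (b (n - i) * x ^ (n - i))) = (\<Sum>i\<le>n. a i * b (n - i)) * x ^ n"
    for a b and x :: real and n :: nat
    unfolding sum_distrib_right
    by (intro sum.cong refl) (simp add: mult_ac flip: power_add)
  have sums: "(\<lambda>n. e n * x ^ n) sums (f x * g x)" if x: "\<bar>x\<bar> \<le> t" for x
    using Cauchy_product_sums[OF smaller[OF c(2) x] smaller[OF d(2) x]]
      c(1)[OF x] d(1)[OF x]
    unfolding conv by (simp add: e_def sums_iff)
  define E where "E n = (\<Sum>i\<le>n. \<bar>c i\<bar> * \<bar>d (n - i)\<bar>)" for n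
  have E: "(\<lambda>n. E n * t ^ n) sums ((\<Sum>n. \<bar>c n\<bar> * t ^ n) * (\<Sum>n. \<bar>d n\<bar> * t ^ n))"
  proof -
    have "(\<lambda>n. \<Sum>i\<le>n. (\<bar>c i\<bar> * t ^ i) * (\<bar>d (n - i)\<bar> * t ^ (n - i))) sums
        ((\<Sum>n. \<bar>c n\<bar> * t ^ n) * (\<Sum>n. \<bar>d n\<bar> * t ^ n))"
      using Cauchy_product_sums[of "\<lambda>n. \<bar>c n\<bar> * t ^ n" "\<lambda>n. \<bar>d n\<bar> * t ^ n"] c(2) d(2) assms(3)
      by (simp add: abs_mult)
    then show ?thesis
      unfolding conv[where a = "\<lambda>i. \<bar>c i\<bar>" and b = "\<lambda>i. \<bar>d i\<bar>"] E_def .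
  qed
  have le: "\<bar>e n\<bar> * t ^ n \<le> E n * t ^ n" for n
  proof -
    have "\<bar>e n\<bar> \<le> E n" unfolding e_def E_def by (rule order_trans[OF sum_abs]) (simp add: abs_mult)
    then show ?thesis using assms(3) by (simp add: mult_right_mono)
  qed
  have sm: "summable (\<lambda>n. \<bar>e n\<bar> * t ^ n)"
    by (rule summable_comparison_test[OF _ sums_summable[OF E]]) (use le assms(3) in auto)
  show ?thesis
  proof (rule powser_boundI[where c = e])
    have "(\<Sum>n. \<bar>e n\<bar> * t ^ n) \<le> (\<Sum>n. \<bar>c n\<bar> * t ^ n) * (\<Sum>n. \<bar>d n\<bar> * t ^ n)"
      using suminf_le[OF le sm sums_summable[OF E]] E by (simp add: sums_iff)
    also have "\<dots> \<le> M * N"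
      using c d powser_bound_nonneg[OF assms(1,3)] assms(3)
      by (intro mult_mono suminf_nonneg) auto
    finally show "(\<Sum>n. \<bar>e n\<bar> * t ^ n) \<le> M * N" .
  qed (use sums sm in auto)
qed

lemma powser_bound_diff:
  assumes "powser_bound t f M" "powser_bound t g N" "t \<ge> 0"
  shows "powser_bound t (\<lambda>x. f x - g x) (M + N)"
  using powser_bound_add[OF assms(1) powser_bound_mult[OF powser_bound_const[of t "-1"] assms(2,3)] assms(3)]
  by simp

lemma powser_bound_power:
  assumes "powser_bound t f M" "t \<ge> 0"
  shows "powser_bound t (\<lambda>x. f x ^ n) (M ^ n)"
proof (induction n)
  case 0
  then show ?case using powser_bound_const[of t 1] by simp
next
  case (Suc n)
  then show ?case using powser_bound_mult[OF assms(1) Suc assms(2)] by simp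
qed

lemma powser_bound_sum:
  assumes "\<And>i. i \<in> A \<Longrightarrow> powser_bound t (f i) (M i)" "t \<ge> 0"
  shows "powser_bound t (\<lambda>x. \<Sum>i\<in>A. f i x) (\<Sum>i\<in>A. M i)"
  using assms
proof (induction A rule: infinite_finite_induct)
  case (insert a A)
  then show ?case by (simp add: powser_bound_add)
qed (use powser_bound_const[of t 0] in simp_all)

lemma powser_bound_cos_sin:
  assumes "t \<ge> 0"
  shows "powser_bound t cos (exp t)" "powser_bound t sin (exp t)"
proof -
  have exp_sums: "(\<lambda>n. inverse (fact n) * t ^ n) sums exp t"
    using exp_converges[of t] by simp
  have "powser_bound t f (exp t)"
    if c: "\<And>n. \<bar>c n\<bar> \<le> inverse (fact n)" and f: "\<And>x. (\<lambda>n. c n * x ^ n) sums f x" for c f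
  proof (rule powser_boundI[OF f])
    have le: "\<bar>c n\<bar> * t ^ n \<le> inverse (fact n) * t ^ n" for n
      using c assms by (simp add: mult_right_mono)
    show sm: "summable (\<lambda>n. \<bar>c n\<bar> * t ^ n)"
      by (rule summable_comparison_test[OF _ sums_summable[OF exp_sums]]) (use le assms in auto)
    show "(\<Sum>n. \<bar>c n\<bar> * t ^ n) \<le> exp t"
      using suminf_le[OF le sm sums_summable[OF exp_sums]] exp_sums by (simp add: sums_iff)
  qed
  note * = this
  have "\<bar>cos_coeff n\<bar> \<le> inverse (fact n)" "\<bar>sin_coeff n\<bar> \<le> inverse (fact n)" for n
    by (simp_all add: cos_coeff_def sin_coeff_def field_simps)
  moreover have "(\<lambda>n. cos_coeff n * x ^ n) sums cos x" "(\<lambda>n. sin_coeff n * x ^ n) sums sin x" for x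
    using cos_converges[of x] sin_converges[of x] by simp_all
  ultimately show "powser_bound t cos (exp t)" "powser_bound t sin (exp t)"
    using * by blast+
qed

lemma powser_bound_hom_part:
  assumes "t \<ge> 0"
  shows "powser_bound t (\<lambda>\<theta>. hom_part F k (cos \<theta>) (sin \<theta>)) ((\<Sum>i\<le>k. \<bar>coef F i (k - i)\<bar>) * exp t ^ k)"
proof -
  have "powser_bound t (\<lambda>\<theta>. hom_part F k (cos \<theta>) (sin \<theta>))
      (\<Sum>i\<le>k. \<bar>coef F i (k - i)\<bar> * exp t ^ i * exp t ^ (k - i))"
    unfolding hom_part_def
    by (intro powser_bound_sum powser_bound_mult powser_bound_const powser_bound_power
        powser_bound_cos_sin assms)
  also have "(\<Sum>i\<le>k. \<bar>coef F i (k - i)\<bar> * exp t ^ i * exp t ^ (k - i)) = (\<Sum>i\<le>k. \<bar>coef F i (k - i)\<bar>) * exp t ^ k"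
    unfolding sum_distrib_right by (intro sum.cong refl) (simp add: mult.assoc flip: power_add)
  finally show ?thesis .
qed

text \<open>The trigonometric polynomials \<open>ang_coeff\<close> and \<open>rad_coeff\<close> are homogeneous of degree
  \<open>k + m + 1\<close> in \<open>cos \<theta>\<close> and \<open>sin \<theta>\<close>, each of which has norm at most \<open>exp t\<close>.\<close>

definition polar_bound :: "nat \<Rightarrow> (real \<Rightarrow> real \<Rightarrow> real) \<Rightarrow> (real \<Rightarrow> real \<Rightarrow> real) \<Rightarrow> nat \<Rightarrow> real \<Rightarrow> real" where
  "polar_bound m X Y k t =
     ((\<Sum>i\<le>k + m. \<bar>coef X i (k + m - i)\<bar>) + (\<Sum>i\<le>k + m. \<bar>coef Y i (k + m - i)\<bar>)) * exp t ^ (k + m + 1)"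

lemma powser_bound_polar:
  assumes "t \<ge> 0"
  shows "powser_bound t (ang_coeff m X Y k) (polar_bound m X Y k t)"
    "powser_bound t (rad_coeff m X Y k) (polar_bound m X Y k t)"
proof -
  note intros = powser_bound_diff powser_bound_add powser_bound_mult powser_bound_hom_part
    powser_bound_cos_sin assms
  have "powser_bound t (ang_coeff m X Y k)
      ((\<Sum>i\<le>k + m. \<bar>coef Y i (k + m - i)\<bar>) * exp t ^ (k + m) * exp t +
       (\<Sum>i\<le>k + m. \<bar>coef X i (k + m - i)\<bar>) * exp t ^ (k + m) * exp t)"
    unfolding ang_coeff_def by (intro intros)
  then show "powser_bound t (ang_coeff m X Y k) (polar_bound m X Y k t)"
    by (simp add: polar_bound_def algebra_simps)
  have "powser_bound t (rad_coeff m X Y k)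
      ((\<Sum>i\<le>k + m. \<bar>coef X i (k + m - i)\<bar>) * exp t ^ (k + m) * exp t +
       (\<Sum>i\<le>k + m. \<bar>coef Y i (k + m - i)\<bar>) * exp t ^ (k + m) * exp t)"
    unfolding rad_coeff_def by (intro intros)
  then show "powser_bound t (rad_coeff m X Y k) (polar_bound m X Y k t)"
    by (simp add: polar_bound_def algebra_simps)
qed

text \<open>Absolute convergence at a point \<open>(s, s)\<close> with \<open>s > 0\<close> bounds the sum over each diagonal
  \<open>i + j = n\<close>, weighted by \<open>s\<^sup>n\<close>, by the total.\<close>

lemma coef_geometric_bound:
  assumes "analytic_at_origin F"
  obtains C q where "C \<ge> 0" "q \<ge> 0" "\<And>n. (\<Sum>i\<le>n. \<bar>coef F i (n - i)\<bar>) \<le> C * q ^ n"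
proof -
  obtain a where a: "has_expansion F a" using assms unfolding analytic_at_origin_def ..
  then have coef: "coef F = a" by (rule coef_eqI)
  obtain r where r: "r > 0" and
    sums: "\<And>x y. \<bar>x\<bar> < r \<and> \<bar>y\<bar> < r \<Longrightarrow> ((\<lambda>(i, j). a i j * x ^ i * y ^ j) has_sum F x y) UNIV"
    using a unfolding has_expansion_def by blast
  define s where "s = r / 2"
  have s: "s > 0" using r by (simp add: s_def)
  have "(\<lambda>(i, j). a i j * s ^ i * s ^ j) summable_on UNIV"
    using sums[of s s] r by (auto simp: summable_on_def s_def)
  then have "(\<lambda>z. norm (case z of (i, j) \<Rightarrow> a i j * s ^ i * s ^ j)) summable_on UNIV"
    by (rule iffD1[OF summable_on_iff_abs_summable_on_real])
  then have sm: "(\<lambda>(i, j). \<bar>a i j\<bar> * s ^ (i + j)) summable_on UNIV"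
    using s by (simp add: case_prod_unfold abs_mult power_add mult.assoc)
  define C where "C = infsum (\<lambda>(i, j). \<bar>a i j\<bar> * s ^ (i + j)) UNIV"
  have bound: "(\<Sum>i\<le>n. \<bar>a i (n - i)\<bar>) * s ^ n \<le> C" for n
  proof -
    have "(\<Sum>i\<le>n. \<bar>a i (n - i)\<bar>) * s ^ n = (\<Sum>(i, j)\<in>(\<lambda>i. (i, n - i)) ` {..n}. \<bar>a i j\<bar> * s ^ (i + j))"
      by (subst sum.reindex) (auto simp: inj_on_def sum_distrib_right)
    also have "\<dots> \<le> C"
      unfolding C_def by (rule finite_sum_le_infsum[OF sm]) (use s in auto)
    finally show ?thesis .
  qed
  show ?thesis
  proof (rule that)
    show "C \<ge> 0" unfolding C_def by (rule infsum_nonneg) (use s in auto)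
    show "1 / s \<ge> 0" using s by simp
    show "(\<Sum>i\<le>n. \<bar>coef F i (n - i)\<bar>) \<le> C * (1 / s) ^ n" for n
      using bound[of n] s by (simp add: coef power_divide field_simps)
  qed
qed

lemma polar_bound_geometric:
  assumes "analytic_at_origin X" "analytic_at_origin Y"
  obtains C q where "C \<ge> 0" "q \<ge> 0" "\<And>k. polar_bound m X Y k 1 \<le> C * q ^ k"
proof -
  obtain C q where X: "C \<ge> 0" "q \<ge> 0" "\<And>n. (\<Sum>i\<le>n. \<bar>coef X i (n - i)\<bar>) \<le> C * q ^ n"
    using coef_geometric_bound[OF assms(1)] by blast
  obtain D p where Y: "D \<ge> 0" "p \<ge> 0" "\<And>n. (\<Sum>i\<le>n. \<bar>coef Y i (n - i)\<bar>) \<le> D * p ^ n"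
    using coef_geometric_bound[OF assms(2)] by blast
  define s where "s = max p q"
  define e where "e = exp (1::real)"
  have s: "p \<le> s" "q \<le> s" "s \<ge> 0" and e: "e \<ge> 0" using X Y by (auto simp: s_def e_def)
  show ?thesis
  proof (rule that)
    fix k
    have "polar_bound m X Y k 1 \<le> (C * s ^ (k + m) + D * s ^ (k + m)) * e ^ (k + m + 1)"
      unfolding polar_bound_def e_def
    proof (intro mult_right_mono add_mono)
      show "(\<Sum>i\<le>k + m. \<bar>coef X i (k + m - i)\<bar>) \<le> C * s ^ (k + m)"
        using X s by (intro order_trans[OF X(3)] mult_left_mono power_mono) auto
      show "(\<Sum>i\<le>k + m. \<bar>coef Y i (k + m - i)\<bar>) \<le> D * s ^ (k + m)"
        using Y s by (intro order_trans[OF Y(3)] mult_left_mono power_mono) auto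
    qed simp
    also have "\<dots> = ((C + D) * s ^ m * e ^ (m + 1)) * (s * e) ^ k"
      by (simp add: algebra_simps power_add power_mult_distrib)
    finally show "polar_bound m X Y k 1 \<le> ((C + D) * s ^ m * e ^ (m + 1)) * (s * e) ^ k" .
  qed (use X Y s e in auto)
qed

text \<open>A power series in \<open>\<rho>\<close> whose coefficients are power series in \<open>\<theta>\<close> with geometrically growing
  norms converges absolutely as a double series, so the expansion at the origin has the same
  coefficients.\<close>

lemma coef_powser_family:
  assumes f: "\<And>k. powser_bound 1 (f k) (C * q ^ k)" and q: "q \<ge> 0" and \<theta>_le: "\<bar>\<theta>\<bar> \<le> 1"
  shows "(\<lambda>n. coef (\<lambda>\<rho> \<theta>. \<Sum>k. f k \<theta> * \<rho> ^ k) k n * \<theta> ^ n) sums f k \<theta>"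
proof -
  let ?F = "\<lambda>\<rho> \<theta>. \<Sum>k. f k \<theta> * \<rho> ^ k"
  have "\<forall>k. \<exists>b. (\<forall>x. \<bar>x\<bar> \<le> 1 \<longrightarrow> (\<lambda>n. b n * x ^ n) sums f k x) \<and>
          summable (\<lambda>n. \<bar>b n\<bar>) \<and> (\<Sum>n. \<bar>b n\<bar>) \<le> C * q ^ k"
    using f unfolding powser_bound_def by simp
  then obtain b where b: "\<And>k x. \<bar>x\<bar> \<le> 1 \<Longrightarrow> (\<lambda>n. b k n * x ^ n) sums f k x"
      "\<And>k. summable (\<lambda>n. \<bar>b k n\<bar>)" "\<And>k. (\<Sum>n. \<bar>b k n\<bar>) \<le> C * q ^ k"
    by metis
  \<comment> \<open>The bound \<open>C * q ^ k\<close> leaves a geometric series in \<open>k\<close> when \<open>q * \<bar>\<rho>\<bar> < 1\<close>, and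
    the norms are taken at \<open>t = 1\<close>; this radius meets both requirements.\<close>
  define r where "r = 1 / (q + 1)"
  have r: "r > 0" "r \<le> 1" "q * r < 1" using q by (auto simp: r_def field_simps)
  have "((\<lambda>(k, n). b k n * \<rho> ^ k * \<theta> ^ n) has_sum ?F \<rho> \<theta>) UNIV"
    if \<rho>: "\<bar>\<rho>\<bar> < r" and \<theta>: "\<bar>\<theta>\<bar> < r" for \<rho> \<theta>
  proof -
    have \<theta>1: "\<bar>\<theta>\<bar> \<le> 1" using \<theta> r by simp
    let ?g = "\<lambda>(k, n). b k n * \<rho> ^ k * \<theta> ^ n"
    have term_le: "norm (?g (k, n)) \<le> \<bar>b k n\<bar> * \<bar>\<rho>\<bar> ^ k" for k n
    proof -
      have "\<bar>b k n\<bar> * \<bar>\<rho>\<bar> ^ k * \<bar>\<theta>\<bar> ^ n \<le> \<bar>b k n\<bar> * \<bar>\<rho>\<bar> ^ k * 1"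
        using \<theta>1 by (intro mult_left_mono power_le_one) auto
      then show ?thesis by (simp add: abs_mult power_abs)
    qed
    have row_summable: "summable (\<lambda>n. norm (?g (k, n)))" for k
      by (rule summable_comparison_test[OF _ summable_mult2[OF b(2), of k "\<bar>\<rho>\<bar> ^ k"]])
        (use term_le in auto)
    have row_le: "(\<Sum>n. norm (?g (k, n))) \<le> C * (q * \<bar>\<rho>\<bar>) ^ k" for k
    proof -
      have "(\<Sum>n. norm (?g (k, n))) \<le> (\<Sum>n. \<bar>b k n\<bar> * \<bar>\<rho>\<bar> ^ k)"
        by (rule suminf_le[OF term_le row_summable summable_mult2[OF b(2)]])
      also have "\<dots> = (\<Sum>n. \<bar>b k n\<bar>) * \<bar>\<rho>\<bar> ^ k"
        by (rule suminf_mult2[OF b(2), symmetric])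
      also have "\<dots> \<le> C * q ^ k * \<bar>\<rho>\<bar> ^ k"
        by (rule mult_right_mono[OF b(3)]) simp
      finally show ?thesis by (simp add: power_mult_distrib mult.assoc)
    qed
    have row_infsum: "infsum (\<lambda>n. norm (?g (k, n))) UNIV = (\<Sum>n. norm (?g (k, n)))" for k
      by (rule infsumI[OF norm_summable_imp_has_sum[OF _ summable_sums]]) (use row_summable[of k] in simp_all)
    have "q * \<bar>\<rho>\<bar> \<le> q * r" using \<rho> q by (intro mult_left_mono) auto
    then have "summable (\<lambda>k. C * (q * \<bar>\<rho>\<bar>) ^ k)"
      using r q by (intro summable_mult summable_geometric) (simp add: abs_mult)
    then have "summable (\<lambda>k. norm (\<Sum>n. norm (?g (k, n))))"
      by (rule summable_comparison_test[rotated])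
        (use row_le in \<open>auto simp: abs_of_nonneg suminf_nonneg row_summable[simplified]\<close>)
    then have "(\<lambda>z. norm (?g z)) summable_on (UNIV \<times> UNIV)"
      unfolding Infinite_Sum.abs_summable_on_Sigma_iff
      using row_summable row_infsum by (auto intro!: norm_summable_imp_summable_on)
    then have "?g summable_on (UNIV \<times> UNIV)"
      by (rule abs_summable_summable)
    then have total: "(?g has_sum infsum ?g UNIV) (UNIV \<times> UNIV)"
      by simp
    have "((\<lambda>n. ?g (k, n)) has_sum f k \<theta> * \<rho> ^ k) UNIV" for k
      using norm_summable_imp_has_sum[OF row_summable[of k]] sums_mult2[OF b(1)[OF \<theta>1], of k "\<rho> ^ k"]
      by (simp add: mult_ac)
    then have "((\<lambda>k. f k \<theta> * \<rho> ^ k) has_sum infsum ?g UNIV) UNIV"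
      by (intro has_sum_SigmaD[OF total]) auto
    then have "?F \<rho> \<theta> = infsum ?g UNIV"
      by (rule sums_unique[OF has_sum_imp_sums, symmetric])
    then show ?thesis using total by simp
  qed
  then have "has_expansion ?F b"
    unfolding has_expansion_def using r(1) by blast
  then have "coef ?F = b" by (rule coef_eqI)
  then show "(\<lambda>n. coef ?F k n * \<theta> ^ n) sums f k \<theta>"
    using b(1)[OF \<theta>_le] by simp
qed

text \<open>This identifies row \<open>k\<close> of the coefficients of \<open>angular\<close> and \<open>radial\<close> with the Taylor
  coefficients of the trigonometric polynomial that multiplies \<open>\<rho>\<^sup>k\<close>.\<close>

lemma polar_coef_sums:
  assumes "analytic_at_origin X" "analytic_at_origin Y" and "\<bar>\<theta>\<bar> \<le> 1"
  shows "(\<lambda>n. coef (angular m X Y) k n * \<theta> ^ n) sums ang_coeff m X Y k \<theta>"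
    "(\<lambda>n. coef (radial m X Y) k n * \<theta> ^ n) sums rad_coeff m X Y k \<theta>"
proof -
  obtain C q where Cq: "C \<ge> 0" "q \<ge> 0" "\<And>k. polar_bound m X Y k 1 \<le> C * q ^ k"
    using polar_bound_geometric[OF assms(1,2), of m] by blast
  have bounds: "powser_bound 1 (ang_coeff m X Y k) (C * q ^ k)"
      "powser_bound 1 (rad_coeff m X Y k) (C * q ^ k)" for k
    by (rule powser_bound_mono[OF powser_bound_polar(1) Cq(3)], simp)
       (rule powser_bound_mono[OF powser_bound_polar(2) Cq(3)], simp)
  show "(\<lambda>n. coef (angular m X Y) k n * \<theta> ^ n) sums ang_coeff m X Y k \<theta>"
    unfolding angular_def[abs_def]
    by (rule coef_powser_family[OF bounds(1) Cq(2) assms(3)])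
  show "(\<lambda>n. coef (radial m X Y) k n * \<theta> ^ n) sums rad_coeff m X Y k \<theta>"
    unfolding radial_def[abs_def]
    by (rule coef_powser_family[OF bounds(2) Cq(2) assms(3)])
qed

text \<open>A bound for every \<open>t\<close> makes \<open>f\<close> the restriction of an entire function, so the identity theorem
  applies.\<close>

lemma powser_bound_eq_zero:
  assumes bound: "\<And>t. t \<ge> 0 \<Longrightarrow> \<exists>M. powser_bound t f M"
    and zero: "\<And>x. \<bar>x\<bar> \<le> 1 \<Longrightarrow> f x = 0"
  shows "f x = 0"
proof -
  obtain M where "powser_bound (1 + \<bar>x\<bar>) f M" using bound[of "1 + \<bar>x\<bar>"] by auto
  then obtain c where c: "\<And>y. \<bar>y\<bar> \<le> 1 + \<bar>x\<bar> \<Longrightarrow> (\<lambda>n. c n * y ^ n) sums f y"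
    unfolding powser_bound_def by blast
  have "c n = 0" for n
  proof (rule powser_zero_coeffs[of 1])
    fix y :: real assume "\<bar>y\<bar> < 1"
    then show "(\<lambda>n. c n * y ^ n) sums 0" using c[of y] zero[of y] by simp
  qed simp
  then show ?thesis using c[of x] by (simp add: sums_iff)
qed

lemma valid_indices_polar_nonempty:
  assumes "analytic_at_origin X" "analytic_at_origin Y"
  shows "\<exists>k \<theta>. ang_coeff m X Y k \<theta> \<noteq> 0 \<Longrightarrow> valid_indices (angular m X Y) \<noteq> {}"
    "\<exists>k \<theta>. rad_coeff m X Y k \<theta> \<noteq> 0 \<Longrightarrow> valid_indices (radial m X Y) \<noteq> {}"
proof -
  have "ang_coeff m X Y k \<theta> = 0" if "valid_indices (angular m X Y) = {}" for k \<theta>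
  proof (rule powser_bound_eq_zero[of "ang_coeff m X Y k"])
    fix t :: real assume "t \<ge> 0"
    then show "\<exists>M. powser_bound t (ang_coeff m X Y k) M" using powser_bound_polar by blast
  next
    fix x :: real assume "\<bar>x\<bar> \<le> 1"
    then show "ang_coeff m X Y k x = 0"
      using polar_coef_sums(1)[OF assms, of x m k] that by (simp add: valid_indices_def sums_iff)
  qed
  then show "\<exists>k \<theta>. ang_coeff m X Y k \<theta> \<noteq> 0 \<Longrightarrow> valid_indices (angular m X Y) \<noteq> {}" by blast
  have "rad_coeff m X Y k \<theta> = 0" if "valid_indices (radial m X Y) = {}" for k \<theta>
  proof (rule powser_bound_eq_zero[of "rad_coeff m X Y k"])
    fix t :: real assume "t \<ge> 0"
    then show "\<exists>M. powser_bound t (rad_coeff m X Y k) M" using powser_bound_polar by blast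
  next
    fix x :: real assume "\<bar>x\<bar> \<le> 1"
    then show "rad_coeff m X Y k x = 0"
      using polar_coef_sums(2)[OF assms, of x m k] that by (simp add: valid_indices_def sums_iff)
  qed
  then show "\<exists>k \<theta>. rad_coeff m X Y k \<theta> \<noteq> 0 \<Longrightarrow> valid_indices (radial m X Y) \<noteq> {}" by blast
qed

lemma hom_part_1_0: "hom_part F k 1 0 = coef F k 0"
proof -
  have "hom_part F k 1 0 = (\<Sum>i\<le>k. if i = k then coef F k 0 else 0)"
    unfolding hom_part_def by (intro sum.cong) (auto simp: power_0_left)
  then show ?thesis by simp
qed

lemma vanishes_on_axis:
  assumes "analytic_at_origin F" and zero: "\<And>k. coef F k 0 = 0"
  obtains r where "r > 0" "\<And>x. \<bar>x\<bar> < r \<Longrightarrow> F x 0 = 0"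
proof -
  obtain a where a: "has_expansion F a" using assms unfolding analytic_at_origin_def by blast
  then have coef: "coef F = a" by (rule coef_eqI)
  obtain r where r: "r > 0" and
    sums: "\<And>x y. \<bar>x\<bar> < r \<and> \<bar>y\<bar> < r \<Longrightarrow> ((\<lambda>(i, j). a i j * x ^ i * y ^ j) has_sum F x y) UNIV"
    using a unfolding has_expansion_def by blast
  have "F x 0 = 0" if "\<bar>x\<bar> < r" for x
  proof -
    have "(\<lambda>(i, j). a i j * x ^ i * 0 ^ j) = (\<lambda>_. 0)"
      using zero by (auto simp: coef power_0_left)
    then have "((\<lambda>_. 0) has_sum F x 0) (UNIV :: (nat \<times> nat) set)" using sums[of x 0] that r by simp
    from infsumI[OF this] show ?thesis by simp
  qed
  then show ?thesis using that r by blast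
qed

text \<open>Without a pure power of \<open>\<rho>\<close> in either series, both the angular and the radial component vanish for
  \<open>\<theta> = 0\<close>. Then \<open>X\<close> and \<open>Y\<close> vanish on the \<open>x\<close>-axis near the origin, and the origin is
  a limit of singular points.\<close>

lemma isolated_imp_some_pure_power:
  assumes an: "analytic_at_origin X" "analytic_at_origin Y"
    and low_order: "\<And>k x y. k < m \<Longrightarrow> hom_part X k x y = 0 \<and> hom_part Y k x y = 0"
    and isolated: "(0, 0) isolated_in {(x, y). X x y = 0 \<and> Y x y = 0}"
  shows "\<exists>k. (k, 0) \<in> valid_indices (angular m X Y) \<or> (k, 0) \<in> valid_indices (radial m X Y)"
proof (rule ccontr)
  assume none: "\<not> ?thesis"
  have at_zero: "(\<lambda>n. b n * 0 ^ n) sums l \<longleftrightarrow> b 0 = l" for b :: "nat \<Rightarrow> real" and l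
    using powser_sums_zero[of b] sums_unique2 by blast
  have "ang_coeff m X Y k 0 = 0" "rad_coeff m X Y k 0 = 0" for k
    using polar_coef_sums[OF an, of 0 m k] none by (simp_all add: at_zero valid_indices_def)
  \<comment> \<open>At \<open>\<theta> = 0\<close> the angular component sees only \<open>Y\<close> and the radial one only \<open>X\<close>.\<close>
  then have high: "coef Y (k + m) 0 = 0" "coef X (k + m) 0 = 0" for k
    by (simp_all add: ang_coeff_def rad_coeff_def hom_part_1_0)
  have "coef X k 0 = 0" "coef Y k 0 = 0" for k
    using low_order[of k 1 0] high[of "k - m"] by (cases "k < m"; simp add: hom_part_1_0)+
  then obtain r s where r: "r > 0" "\<And>x. \<bar>x\<bar> < r \<Longrightarrow> X x 0 = 0" and s: "s > 0" "\<And>x. \<bar>x\<bar> < s \<Longrightarrow> Y x 0 = 0"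
    using vanishes_on_axis[OF an(1)] vanishes_on_axis[OF an(2)] by metis
  obtain e where e: "e > 0"
      "\<And>p. p \<in> {(x, y). X x y = 0 \<and> Y x y = 0} \<Longrightarrow> dist (0, 0) p < e \<Longrightarrow> p = (0, 0)"
    using isolated unfolding isolated_in_dist_Ex_iff by blast
  define x where "x = min e (min r s) / 2"
  have x: "0 < x" "x < e" "x < r" "x < s" using e(1) r(1) s(1) by (auto simp: x_def)
  have "(x, 0) = (0, 0::real)"
    using x r(2)[of x] s(2)[of x] by (intro e(2)) (auto simp: dist_Pair_Pair)
  then show False using x by simp
qed


section \<open>The theorem\<close>

lemma block_no_common_slopes:
  assumes "valid_indices F \<noteq> {}"
  shows "set (block [] F 0) = set (vertices F)"
proof -
  have "block [] F 0 = map (vertex F) [0..<length (vertices F)]"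
    using length_vertices[OF assms] by (simp add: block_def cut_index_def)
  then show ?thesis by (simp add: map_nth)
qed

theorem corollary2p2:
  fixes X Y :: "real \<Rightarrow> real \<Rightarrow> real" and m :: nat and G H :: "real \<Rightarrow> real \<Rightarrow> real"
  assumes analytic: "analytic_at_origin X" "analytic_at_origin Y"
    and m: "m \<ge> 2"
    and low_order: "\<And>k x y. k < m \<Longrightarrow> hom_part X k x y = 0 \<and> hom_part Y k x y = 0"
    and leading: "\<exists>x y. (hom_part X m x y)\<^sup>2 + (hom_part Y m x y)\<^sup>2 \<noteq> 0"
    and isolated: "(0, 0) isolated_in {(x, y). X x y = 0 \<and> Y x y = 0}"
    and G_def: "G = angular m X Y" and H_def: "H = radial m X Y"
    and G_nonzero: "\<exists>k \<theta>. ang_coeff m X Y k \<theta> \<noteq> 0"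
    and H_nonzero: "\<exists>k \<theta>. rad_coeff m X Y k \<theta> \<noteq> 0"
    and zero_direction: "ang_coeff m X Y 0 0 = 0" "rad_coeff m X Y 0 0 = 0"
    and NP: "slopes G \<inter> slopes H = {}"
    and T: "newton_polygon G \<inter> pt ` valid_indices G = pt ` set (vertices G)"
           "newton_polygon H \<inter> pt ` valid_indices H = pt ` set (vertices H)"
    and cases:
      "(last_ordinate G + last_ordinate H > 0 \<and>
        (\<forall>\<rho>\<le>length (common_slopes G H).
           opposite_parities (block (common_slopes G H) G \<rho>) (block (common_slopes G H) H \<rho>)) \<and>
        same_sign (C_const G H ` {0..length (all_slopes G H)}))
       \<or>
       (last_ordinate G = 0 \<and> last_ordinate H = 0 \<and>
        (\<forall>\<rho><length (common_slopes G H).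
           opposite_parities (block (common_slopes G H) G \<rho>) (block (common_slopes G H) H \<rho>)) \<and>
        (\<forall>z\<in>set (butlast (block (common_slopes G H) G (length (common_slopes G H)))). odd (snd z)) \<and>
        (\<forall>z\<in>set (block (common_slopes G H) H (length (common_slopes G H))). even (snd z)) \<and>
        length (polygon_indices G) \<ge> 2 \<and> length (polygon_indices H) \<ge> 2 \<and>
        last (polygon_indices G) = vertex G (num_edges G) \<and>
        last (polygon_indices H) = vertex H (num_edges H) \<and>
        {(i, j) \<in> valid_indices G. 0 < j \<and> j < star_ordinate G} = {} \<and>
        {(i, j) \<in> valid_indices H. 0 < j \<and> j < star_ordinate H} = {} \<and>
        zeta G (num_edges G) > zeta H (num_edges H) \<and>
        star_ordinate G \<le> star_ordinate H \<and>
        same_sign (C_const G H ` {0..<length (all_slopes G H)}))"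
  shows "N_num G = sign_changes (A_seq G @ Aj_seq G) \<and>
         N_num H = sign_changes (A_seq H @ Aj_seq H)"
proof -
  have neG: "valid_indices G \<noteq> {}" and neH: "valid_indices H \<noteq> {}"
    unfolding G_def H_def using valid_indices_polar_nonempty[OF analytic] G_nonzero H_nonzero by blast+
  have "(last_ordinate G = 0 \<or> odd (last_ordinate G)) \<and> (last_ordinate H = 0 \<or> odd (last_ordinate H))"
    using cases
  proof (elim disjE conjE)
    \<comment> \<open>In case (i) one last ordinate is odd by the parity condition, the other is zero by isolatedness.\<close>
    assume pos: "last_ordinate G + last_ordinate H > 0"
      and par: "\<forall>\<rho>\<le>length (common_slopes G H).
           opposite_parities (block (common_slopes G H) G \<rho>) (block (common_slopes G H) H \<rho>)"
    have "common_slopes G H = []" using NP by (simp add: common_slopes_def)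
    then have "opposite_parities (block [] G 0) (block [] H 0)" using par by simp
    then have "(\<forall>z\<in>set (vertices G). even (snd z)) \<and> (\<forall>z\<in>set (vertices H). odd (snd z)) \<or>
        (\<forall>z\<in>set (vertices G). odd (snd z)) \<and> (\<forall>z\<in>set (vertices H). even (snd z))"
      unfolding opposite_parities_def block_no_common_slopes[OF neG] block_no_common_slopes[OF neH] .
    moreover have "vertex G (num_edges G) \<in> set (vertices G)" "vertex H (num_edges H) \<in> set (vertices H)"
      using length_vertices[OF neG] length_vertices[OF neH] by simp_all
    ultimately have "odd (last_ordinate G) \<or> odd (last_ordinate H)"
      unfolding last_ordinate_def by blast
    moreover have "\<exists>k. (k, 0) \<in> valid_indices G \<or> (k, 0) \<in> valid_indices H"
      unfolding G_def H_def
      by (rule isolated_imp_some_pure_power[OF analytic _ isolated]) (rule low_order)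
    then have "last_ordinate G = 0 \<or> last_ordinate H = 0"
      using last_ordinate_le by fastforce
    ultimately show ?thesis by auto
  qed simp
  then show ?thesis
    using N_num_eq_sign_changes[OF neG T(1)] N_num_eq_sign_changes[OF neH T(2)] by blast
qed

end
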